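(* Suppose $X$ is a polyhedron and $\Lambda_X(\mathcal{A})$ is nonempty. Then $\Lambda_X^\star(\mathcal{A})$ is finite and \[C_X(\mathcal{A})=\sum_{\lambda\in\Lambda_X^\star(\mathcal{A})}C_X(\mathcal{A},\lambda)\quad\text{(Minkowski sum)}.\] Moreover, there is no proper subset $\Lambda\subsetneq\Lambda_X^\star(\mathcal{A})$ for which $C_X(\mathcal{A})=\sum_{\lambda\in\Lambda}C_X(\mathcal{A},\lambda)$.
   Context: $X\subset\mathbb{R}^n$ is a nonempty closed convex set and $\mathcal{A}\subset\mathbb{R}^n$ is a nonempty finite set such that the functions $x\mapsto\exp(\alpha^Tx)$, $\alpha\in\mathcal{A}$, are linearly independent on $X$. $\mathbb{R}^{\mathcal{A}}$ denotes real vectors indexed by $\mathcal{A}$. $\mathcal{A}\nu=\sum_\alpha\alpha\nu_\alpha$. $\sigma_X(y)=\sup\{y^Tx:x\in X\}$. $N_\beta=\{\nu\in\mathbb{R}^{\mathcal{A}}:\nu_\alpha\ge0\ \forall\alpha\neq\beta,\ \sum_\alpha\nu_\alpha=0\}$. A vector $\nu^\star\in N_\beta$ is an $X$-circuit of $\mathcal{A}$ if (1) $\nu^\star\neq0$, (2) $\sigma_X(-\mathcal{A}\nu^\star)<\infty$, and (3) $\nu^\star$ cannot be written as a convex combination of two non-proportional vectors $\nu^{(1)},\nu^{(2)}\in N_\beta$ such that the map $\nu\mapsto\sigma_X(-\mathcal{A}\nu)$ is affine on the segment $[\nu^{(1)},\nu^{(2)}]$. $\Lambda_X(\mathcal{A})$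 is the set of all $X$-circuits $\lambda$ (over all $\beta\in\mathcal{A}$) normalized so that the unique negative entry equals $-1$. The functional form of $\lambda\in\Lambda_X(\mathcal{A})$ is $\phi_\lambda=(\lambda,\sigma_X(-\mathcal{A}\lambda))\in\mathbb{R}^{\mathcal{A}}\times\mathbb{R}$. The circuit graph is $G_X(\mathcal{A})=\operatorname{cone}(\{\phi_\lambda:\lambda\in\Lambda_X(\mathcal{A})\}\cup\{(0,1)\})$. The set of normalized reduced $X$-circuits $\Lambda_X^\star(\mathcal{A})$ consists of those $\lambda\in\Lambda_X(\mathcal{A})$ for which $\{t\phi_\lambda:t\ge0\}$ is an extreme ray of $G_X(\mathcal{A})$. Signomials $f=\sum_\alpha c_\alpha\mathrm{e}^\alpha$, $\mathrm{e}^\alpha(x)=\exp(\alpha^Tx)$, are identified with $c\in\mathbb{R}^{\mathcal{A}}$; $C_X(\mathcal{A},\beta)$ is the set of $c$ with $f$ nonnegative on $X$ and $c_\alpha\ge0$ for $\alpha\ne\beta$, and $C_X(\mathcal{A})=\sum_{\beta\in\mathcal{A}}C_X(\mathcal{A},\beta)$. For $\lambda\in\Lambda_X(\mathcal{A})$ with negative index $\beta$ and $\lambda^+=\{\alpha:\lambda_\alpha>0\}$, the $\lambda$-witnessed AGE cone is $C_X(\mathcal{A},\lambda)=\{c: c_\alpha\ge0\ \forall\alpha\neq\beta,\ \prod_{\alpha\in\lambda^+}(c_\alpha/\lambda_\alpha)^{\lambda_\alpha}\ge -c_\beta\exp(\sigma_X(-\mathcal{A}\lambda))\}$. *)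

theory Defs
  imports "HOL-Analysis.Analysis"
begin

text \<open>Vectors in R^A are functions 'a => real vanishing outside A.
  X is a subset of a Euclidean space 'a (playing the role of R^n).\<close>

definition in_RA :: "'a set \<Rightarrow> ('a \<Rightarrow> real) \<Rightarrow> bool" where
  "in_RA A c \<longleftrightarrow> (\<forall>\<alpha>. \<alpha> \<notin> A \<longrightarrow> c \<alpha> = 0)"

definition supp_fun :: "'a::euclidean_space set \<Rightarrow> 'a \<Rightarrow> ereal" where
  "supp_fun X y = (SUP x\<in>X. ereal (y \<bullet> x))"

definition Amul :: "'a::euclidean_space set \<Rightarrow> ('a \<Rightarrow> real) \<Rightarrow> 'a" where
  "Amul A \<nu> = (\<Sum>\<alpha>\<in>A. \<nu> \<alpha> *\<^sub>R \<alpha>)"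

definition Nbeta :: "'a set \<Rightarrow> 'a \<Rightarrow> ('a \<Rightarrow> real) set" where
  "Nbeta A \<beta> = {\<nu>. in_RA A \<nu> \<and> (\<forall>\<alpha>\<in>A. \<alpha> \<noteq> \<beta> \<longrightarrow> \<nu> \<alpha> \<ge> 0) \<and> (\<Sum>\<alpha>\<in>A. \<nu> \<alpha>) = 0}"

definition proportional :: "('a \<Rightarrow> real) \<Rightarrow> ('a \<Rightarrow> real) \<Rightarrow> bool" where
  "proportional u v \<longleftrightarrow> (\<exists>t::real. u = (\<lambda>\<alpha>. t * v \<alpha>)) \<or> (\<exists>t::real. v = (\<lambda>\<alpha>. t * u \<alpha>))"

definition affine_on_segment ::
  "'a::euclidean_space set \<Rightarrow> 'a set \<Rightarrow> ('a \<Rightarrow> real) \<Rightarrow> ('a \<Rightarrow> real) \<Rightarrow> bool" where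
  "affine_on_segment X A \<nu>1 \<nu>2 \<longleftrightarrow>
     (\<exists>a b :: real. \<forall>t\<in>{0..1}.
        supp_fun X (- Amul A (\<lambda>\<alpha>. (1 - t) * \<nu>1 \<alpha> + t * \<nu>2 \<alpha>)) = ereal (a + b * t))"

definition X_circuit :: "'a::euclidean_space set \<Rightarrow> 'a set \<Rightarrow> 'a \<Rightarrow> ('a \<Rightarrow> real) \<Rightarrow> bool" where
  "X_circuit X A \<beta> \<nu> \<longleftrightarrow>
     \<nu> \<in> Nbeta A \<beta> \<and> \<nu> \<noteq> (\<lambda>_. 0) \<and> supp_fun X (- Amul A \<nu>) < \<infinity> \<and>
     \<not> (\<exists>\<nu>1 \<nu>2 \<theta>. \<nu>1 \<in> Nbeta A \<beta> \<and> \<nu>2 \<in> Nbeta A \<beta> \<and> \<not> proportional \<nu>1 \<nu>2 \<and>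
          \<theta> \<in> {0<..<1::real} \<and> \<nu> = (\<lambda>\<alpha>. \<theta> * \<nu>1 \<alpha> + (1 - \<theta>) * \<nu>2 \<alpha>) \<and>
          affine_on_segment X A \<nu>1 \<nu>2)"

definition Lambda_X :: "'a::euclidean_space set \<Rightarrow> 'a set \<Rightarrow> ('a \<Rightarrow> real) set" where
  "Lambda_X X A = {lam. \<exists>\<beta>\<in>A. X_circuit X A \<beta> lam \<and> lam \<beta> = -1}"

definition funform :: "'a::euclidean_space set \<Rightarrow> 'a set \<Rightarrow> ('a \<Rightarrow> real) \<Rightarrow> ('a \<Rightarrow> real) \<times> real" where
  "funform X A lam = (lam, real_of_ereal (supp_fun X (- Amul A lam)))"

definition cone_hull :: "(('a \<Rightarrow> real) \<times> real) set \<Rightarrow> (('a \<Rightarrow> real) \<times> real) set" where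
  "cone_hull S = {((\<lambda>\<alpha>. \<Sum>s\<in>F. t s * fst s \<alpha>), (\<Sum>s\<in>F. t s * snd s)) | F t.
                   finite F \<and> F \<subseteq> S \<and> (\<forall>s\<in>F. t s \<ge> 0)}"

definition circuit_graph :: "'a::euclidean_space set \<Rightarrow> 'a set \<Rightarrow> (('a \<Rightarrow> real) \<times> real) set" where
  "circuit_graph X A = cone_hull (funform X A ` Lambda_X X A \<union> {((\<lambda>_. 0), 1)})"

definition ray :: "('a \<Rightarrow> real) \<times> real \<Rightarrow> (('a \<Rightarrow> real) \<times> real) set" where
  "ray p = {((\<lambda>\<alpha>. t * fst p \<alpha>), t * snd p) | t. t \<ge> (0::real)}"

definition extreme_ray :: "(('a \<Rightarrow> real) \<times> real) set \<Rightarrow> ('a \<Rightarrow> real) \<times> real \<Rightarrow> bool" where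
  "extreme_ray G p \<longleftrightarrow> p \<noteq> ((\<lambda>_. 0), 0) \<and> p \<in> G \<and>
     (\<forall>x\<in>G. \<forall>y\<in>G. ((\<lambda>\<alpha>. fst x \<alpha> + fst y \<alpha>), snd x + snd y) \<in> ray p \<longrightarrow> x \<in> ray p \<and> y \<in> ray p)"

definition Lambda_X_star :: "'a::euclidean_space set \<Rightarrow> 'a set \<Rightarrow> ('a \<Rightarrow> real) set" where
  "Lambda_X_star X A = {lam\<in>Lambda_X X A. extreme_ray (circuit_graph X A) (funform X A lam)}"

definition signomial :: "'a::euclidean_space set \<Rightarrow> ('a \<Rightarrow> real) \<Rightarrow> 'a \<Rightarrow> real" where
  "signomial A c x = (\<Sum>\<alpha>\<in>A. c \<alpha> * exp (\<alpha> \<bullet> x))"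

definition SAGE_beta :: "'a::euclidean_space set \<Rightarrow> 'a set \<Rightarrow> 'a \<Rightarrow> ('a \<Rightarrow> real) set" where
  "SAGE_beta X A \<beta> = {c. in_RA A c \<and> (\<forall>\<alpha>\<in>A. \<alpha> \<noteq> \<beta> \<longrightarrow> c \<alpha> \<ge> 0) \<and>
                          (\<forall>x\<in>X. signomial A c x \<ge> 0)}"

text \<open>Minkowski sum of a family of subsets of R^A indexed by a finite set I (empty sum = {0}).\<close>
definition msum :: "'i set \<Rightarrow> ('i \<Rightarrow> ('a \<Rightarrow> real) set) \<Rightarrow> ('a \<Rightarrow> real) set" where
  "msum I C = {c. \<exists>cs. (\<forall>i\<in>I. cs i \<in> C i) \<and> c = (\<lambda>\<alpha>. \<Sum>i\<in>I. cs i \<alpha>)}"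

definition SAGE :: "'a::euclidean_space set \<Rightarrow> 'a set \<Rightarrow> ('a \<Rightarrow> real) set" where
  "SAGE X A = msum A (SAGE_beta X A)"

definition neg_idx :: "'a set \<Rightarrow> ('a \<Rightarrow> real) \<Rightarrow> 'a" where
  "neg_idx A lam = (THE \<beta>. \<beta> \<in> A \<and> lam \<beta> < 0)"

definition AGE_lambda :: "'a::euclidean_space set \<Rightarrow> 'a set \<Rightarrow> ('a \<Rightarrow> real) \<Rightarrow> ('a \<Rightarrow> real) set" where
  "AGE_lambda X A lam = {c. in_RA A c \<and> (\<forall>\<alpha>\<in>A. \<alpha> \<noteq> neg_idx A lam \<longrightarrow> c \<alpha> \<ge> 0) \<and>
      (\<Prod>\<alpha>\<in>{\<alpha>\<in>A. lam \<alpha> > 0}. (c \<alpha> / lam \<alpha>) powr (lam \<alpha>))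
        \<ge> - c (neg_idx A lam) * exp (real_of_ereal (supp_fun X (- Amul A lam)))}"

definition exp_lin_indep_on :: "'a::euclidean_space set \<Rightarrow> 'a set \<Rightarrow> bool" where
  "exp_lin_indep_on X A \<longleftrightarrow>
     (\<forall>c. (\<forall>x\<in>X. (\<Sum>\<alpha>\<in>A. c \<alpha> * exp (\<alpha> \<bullet> x)) = 0) \<longrightarrow> (\<forall>\<alpha>\<in>A. c \<alpha> = 0))"

end

theory Submission
  imports Defs "HOL-Library.Function_Algebras"
begin

text \<open>
  For polyhedral \<open>X\<close> the epigraph of \<open>\<nu> \<mapsto> \<sigma>\<^sub>X(- A \<nu>)\<close> over \<open>N\<^sub>\<beta>\<close> is a finitely generated pointed cone
  whose extreme rays are \<open>(0, 1)\<close> or functional forms of circuits. Hence the circuit graph is finitely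
  generated, and it is pointed because the exponentials are linearly independent on \<open>X\<close>; so its
  extreme rays are finite in number and generate it.

  A positive vector \<open>e\<^sup>y\<close> is nonnegative on the \<open>\<lambda>\<close>-witnessed AGE cone iff \<open>\<lambda> \<bullet> y + \<sigma>\<^sub>X(- A \<lambda>) \<ge> 0\<close>,
  i.e. iff \<open>(y, 1)\<close> is nonnegative on the functional form of \<open>\<lambda>\<close>. If \<open>e\<^sup>y\<close> separates \<open>c\<close> from the (closed)
  sum over reduced circuits, then \<open>(y, 1)\<close> is nonnegative on the whole circuit graph, and Farkas'
  lemma yields \<open>x \<in> X\<close> with \<open>(\<alpha> - \<beta>) \<bullet> x \<le> y\<^sub>\<alpha> - y\<^sub>\<beta>\<close> for all \<open>\<alpha>\<close>; at this \<open>x\<close> an AGE signomial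
  with coefficients \<open>c\<close> would be negative. Conversely, a reduced circuit is not in the cone of the others,
  so Farkas' lemma gives a \<open>y\<close> that is feasible for the others but not for it.
\<close>

section \<open>Functions as a real vector space\<close>

text \<open>Vectors over \<open>A\<close> live in the full function type, an infinite-dimensional
  real vector space without an inner product. Hence Farkas' lemma is proved for arbitrary real
  vector spaces, extreme rays are handled algebraically through finite generating sets, and limits
  are taken in the product topology. The analytic obstacle is closedness of the sum of witnessed
  cones, since a sum of closed cones need not be closed; it is overcome by a point that is strictly
  feasible for all reduced circuits, which exists because the circuit graph is pointed. Neither
  separation yields a pair \<open>(y, 1)\<close> at once: a separating functional may have zero
  entries and then is no exponential, and Farkas' lemma may return \<open>(y, r)\<close> with
  \<open>r = 0\<close>. Both defects are repaired by adding a small multiple of the evaluation at a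
  point of \<open>X\<close>, which is feasible for every circuit.\<close>

instantiation "fun" :: (type, real_vector) real_vector
begin

definition scaleR_fun_def: "r *\<^sub>R f = (\<lambda>x. r *\<^sub>R f x)"

instance
  by standard (auto simp: scaleR_fun_def scaleR_add_right scaleR_add_left fun_eq_iff)

end

lemma scaleR_fun_apply [simp]: "(r *\<^sub>R f) x = r *\<^sub>R f x"
  by (simp add: scaleR_fun_def)

lemma sum_fun_apply: "(\<Sum>i\<in>I. f i) x = (\<Sum>i\<in>I. f i x)"
  by (induction I rule: infinite_finite_induct) auto

section \<open>Farkas' lemma\<close>

text \<open>Bartl's induction: if a point \<open>w\<close> violates the conclusion only because of the new constraint
  \<open>f k\<close>, project along \<open>w\<close> onto the kernel of \<open>f k\<close> and apply the hypothesis there.\<close>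

lemma farkas:
  fixes f :: "'i \<Rightarrow> 'v::real_vector \<Rightarrow> real" and g :: "'v \<Rightarrow> real"
  assumes "finite I" "\<And>i. i \<in> I \<Longrightarrow> linear (f i)" "linear g"
    and "\<And>x. (\<And>i. i \<in> I \<Longrightarrow> f i x \<ge> 0) \<Longrightarrow> g x \<ge> 0"
  obtains t where "\<And>i. i \<in> I \<Longrightarrow> t i \<ge> 0" "\<And>x. g x = (\<Sum>i\<in>I. t i * f i x)"
proof -
  have "\<exists>t. (\<forall>i\<in>I. t i \<ge> 0) \<and> (\<forall>x. g x = (\<Sum>i\<in>I. t i * f i x))"
    using assms
  proof (induction I arbitrary: f g rule: finite_induct)
    case empty
    have "g x = 0" for x
      using empty.prems(3)[of x] empty.prems(3)[of "-x"] linear_neg[OF empty.prems(2), of x]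
      by simp
    then show ?case by simp
  next
    case (insert k I)
    show ?case
    proof (cases "\<forall>x. (\<forall>i\<in>I. f i x \<ge> 0) \<longrightarrow> g x \<ge> 0")
      case True
      then obtain t where t: "\<forall>i\<in>I. t i \<ge> 0" "\<forall>x. g x = (\<Sum>i\<in>I. t i * f i x)"
        using insert.IH[of f g] insert.prems by auto
      have "(\<Sum>i\<in>insert k I. (t(k := 0)) i * f i x) = (\<Sum>i\<in>I. t i * f i x)" for x
      proof -
        have "(\<Sum>i\<in>I. (t(k := 0)) i * f i x) = (\<Sum>i\<in>I. t i * f i x)"
          by (rule sum.cong) (use insert.hyps in auto)
        then show ?thesis using insert.hyps by simp
      qed
      then show ?thesis using t by (intro exI[of _ "t(k := 0)"]) auto
    next
      case False
      then obtain z where z: "\<forall>i\<in>I. f i z \<ge> 0" "g z < 0" by force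
      have lk: "linear (f k)" and lf: "\<And>i. i \<in> I \<Longrightarrow> linear (f i)" using insert.prems by auto
      have fkz: "f k z < 0"
        using z insert.prems(3)[of z] by force
      \<comment> \<open>Scaled so that \<open>f k w = -1\<close>; then
        \<open>x + f k x *\<^sub>R w\<close> lies in the kernel of \<open>f k\<close> for every
        \<open>x\<close>.\<close>
      define w where "w = (- 1 / f k z) *\<^sub>R z"
      have w: "\<forall>i\<in>I. f i w \<ge> 0" "g w < 0" "f k w = -1"
        unfolding w_def using z fkz
        by (auto simp: linear_cmul[OF lf] linear_cmul[OF lk] linear_cmul[OF insert.prems(2)]
            divide_nonneg_neg zero_less_divide_iff simp del: scaleR_minus_left)
      let ?p = "\<lambda>x. x + f k x *\<^sub>R w"
      have lp: "linear ?p"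
        using lk by (intro linear_compose_add linear_id) (auto intro!: linearI simp: linear_add linear_cmul algebra_simps)
      have "\<exists>t. (\<forall>i\<in>I. t i \<ge> 0) \<and> (\<forall>x. (g \<circ> ?p) x = (\<Sum>i\<in>I. t i * (f i \<circ> ?p) x))"
      proof (rule insert.IH)
        show "linear (f i \<circ> ?p)" if "i \<in> I" for i
          by (rule linear_compose[OF lp lf[OF that]])
        show "linear (g \<circ> ?p)"
          by (rule linear_compose[OF lp insert.prems(2)])
        fix x assume x: "\<And>i. i \<in> I \<Longrightarrow> (f i \<circ> ?p) x \<ge> 0"
        have "f k (?p x) = 0"
          using w(3) by (simp add: linear_add[OF lk] linear_cmul[OF lk])
        then show "(g \<circ> ?p) x \<ge> 0"
          using x insert.prems(3)[of "?p x"] by force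
      qed
      then obtain t where t: "\<forall>i\<in>I. t i \<ge> 0" "\<And>x. g (?p x) = (\<Sum>i\<in>I. t i * f i (?p x))"
        by auto
      \<comment> \<open>The coefficient of \<open>f k\<close> that is left over once the identity
        for \<open>g\<close> at the projected point is expanded.\<close>
      define c where "c = (\<Sum>i\<in>I. t i * f i w) - g w"
      have "(\<Sum>i\<in>I. t i * f i w) \<ge> 0"
        using t(1) w(1) by (intro sum_nonneg) auto
      then have c: "c \<ge> 0" using w(2) by (simp add: c_def)
      have "g x = (\<Sum>i\<in>insert k I. (t(k := c)) i * f i x)" for x
      proof -
        have "g x + f k x * g w = (\<Sum>i\<in>I. t i * (f i x + f k x * f i w))"
          using t(2)[of x] lf insert.prems(2) by (simp add: linear_add linear_cmul)
        also have "\<dots> = (\<Sum>i\<in>I. t i * f i x) + f k x * (\<Sum>i\<in>I. t i * f i w)"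
          by (simp add: algebra_simps sum.distrib sum_distrib_left)
        finally have "g x = (\<Sum>i\<in>I. t i * f i x) + c * f k x"
          by (simp add: c_def algebra_simps)
        moreover have "(\<Sum>i\<in>I. (t(k := c)) i * f i x) = (\<Sum>i\<in>I. t i * f i x)"
          by (rule sum.cong) (use insert.hyps in auto)
        ultimately show ?thesis using insert.hyps by simp
      qed
      then show ?thesis
        using t(1) c by (intro exI[of _ "t(k := c)"]) auto
    qed
  qed
  then show thesis using that by blast
qed

text \<open>Homogenisation: a point \<open>(x, r)\<close> with \<open>r > 0\<close> satisfying the
  scaled system would give the solution \<open>x / r\<close>, so \<open>- r\<close> is nonnegative
  on the whole cone. In the resulting combination \<open>r = 0\<close> isolates the normals, and
  \<open>x = 0\<close>, \<open>r = 1\<close> the offsets.\<close>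

lemma farkas_infeasible:
  fixes a :: "'i \<Rightarrow> 'v::euclidean_space" and b :: "'i \<Rightarrow> real"
  assumes "finite I" and "\<nexists>x. \<forall>i\<in>I. a i \<bullet> x \<le> b i"
  obtains t where "\<And>i. i \<in> I \<Longrightarrow> t i \<ge> 0" "(\<Sum>i\<in>I. t i *\<^sub>R a i) = 0" "(\<Sum>i\<in>I. t i * b i) < 0"
proof -
  let ?f = "\<lambda>j (x, r). case j of None \<Rightarrow> r | Some i \<Rightarrow> r * b i - a i \<bullet> x"
  have nonneg: "- snd p \<ge> 0" if p: "\<And>j. j \<in> insert None (Some ` I) \<Longrightarrow> ?f j p \<ge> 0" for p :: "'v \<times> real"
  proof (rule ccontr)
    assume "\<not> - snd p \<ge> 0"
    then have r: "snd p > 0" by simp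
    have "a i \<bullet> (fst p /\<^sub>R snd p) \<le> b i" if "i \<in> I" for i
      using p[of "Some i"] that r by (auto simp: field_simps split: prod.splits)
    then show False using assms(2) by blast
  qed
  obtain t where t: "\<And>j. j \<in> insert None (Some ` I) \<Longrightarrow> t j \<ge> 0"
      "\<And>p. - snd p = (\<Sum>j\<in>insert None (Some ` I). t j * ?f j p)"
  proof (rule farkas[where I = "insert None (Some ` I)" and f = ?f and g = "\<lambda>p. - snd p"])
    show "linear (?f j)" for j
      by (cases j) (auto intro!: linearI simp: algebra_simps inner_add_right inner_scaleR_right)
    show "linear (\<lambda>p::'v \<times> real. - snd p)"
      by (intro linearI) auto
  qed (use assms(1) nonneg in auto)
  have eq: "- r = t None * r + (\<Sum>i\<in>I. t (Some i) * (r * b i - a i \<bullet> x))" for x r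
    using t(2)[of "(x, r)"] assms(1) by (simp add: sum.reindex)
  show thesis
  proof (rule that[of "\<lambda>i. t (Some i)"])
    have "(\<Sum>i\<in>I. t (Some i) *\<^sub>R a i) \<bullet> x = 0" for x
      using eq[of 0 x] by (simp add: inner_sum_left sum_negf)
    then show "(\<Sum>i\<in>I. t (Some i) *\<^sub>R a i) = 0"
      using inner_eq_zero_iff by blast
    show "(\<Sum>i\<in>I. t (Some i) * b i) < 0"
      using eq[of 1 0] t(1)[of None] by simp
  qed (use t in auto)
qed

text \<open>The same homogenisation, but now the points with \<open>r = 0\<close> matter: they are
  recession directions of the polyhedron, and the feasible point \<open>x0\<close> is what allows
  moving along them.\<close>

lemma farkas_affine:
  fixes a :: "'i \<Rightarrow> 'v::euclidean_space" and b :: "'i \<Rightarrow> real"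
  assumes "finite I" and x0: "\<forall>i\<in>I. a i \<bullet> x0 \<le> b i"
    and w: "\<And>x. \<forall>i\<in>I. a i \<bullet> x \<le> b i \<Longrightarrow> w \<bullet> x \<le> \<tau>"
  obtains t where "\<And>i. i \<in> I \<Longrightarrow> t i \<ge> 0" "w = (\<Sum>i\<in>I. t i *\<^sub>R a i)" "(\<Sum>i\<in>I. t i * b i) \<le> \<tau>"
proof -
  let ?f = "\<lambda>j (x, r). case j of None \<Rightarrow> r | Some i \<Rightarrow> r * b i - a i \<bullet> x"
  let ?g = "\<lambda>(x, r). r * \<tau> - w \<bullet> x"
  have nonneg: "?g p \<ge> 0" if p: "\<And>j. j \<in> insert None (Some ` I) \<Longrightarrow> ?f j p \<ge> 0" for p :: "'v \<times> real"
  proof -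
    obtain x r where xr: "p = (x, r)" by (cases p)
    have r: "r \<ge> 0" and i: "\<And>i. i \<in> I \<Longrightarrow> a i \<bullet> x \<le> r * b i"
      using p[of None] p[of "Some _"] by (auto simp: xr)
    show ?thesis
    proof (cases "r = 0")
      case False
      then have "w \<bullet> (x /\<^sub>R r) \<le> \<tau>"
        using i r by (intro w) (auto simp: field_simps)
      then show ?thesis using False r by (simp add: xr field_simps)
    next
      case True
      have *: "w \<bullet> x0 + k * (w \<bullet> x) \<le> \<tau>" if "k \<ge> 0" for k
      proof -
        have "a j \<bullet> (x0 + k *\<^sub>R x) \<le> b j" if "j \<in> I" for j
          using x0 that i[OF that] True \<open>k \<ge> 0\<close> mult_nonneg_nonpos[of k "a j \<bullet> x"]
          by (auto simp: inner_add_right intro: add_mono[of _ "b j" _ 0, simplified])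
        then show ?thesis using w[of "x0 + k *\<^sub>R x"] by (simp add: inner_add_right)
      qed
      have "w \<bullet> x \<le> 0"
      proof (rule ccontr)
        assume "\<not> w \<bullet> x \<le> 0"
        \<comment> \<open>With this step length the value of \<open>w\<close> is
          \<open>w \<bullet> x0 + \<bar>\<tau> - w \<bullet> x0\<bar> + 1\<close>, which exceeds
          \<tau>.\<close>
        then show False
          using *[of "(\<bar>\<tau> - w \<bullet> x0\<bar> + 1) / (w \<bullet> x)"] by simp
      qed
      then show ?thesis using True by (simp add: xr)
    qed
  qed
  obtain t where t: "\<And>j. j \<in> insert None (Some ` I) \<Longrightarrow> t j \<ge> 0"
      "\<And>p. ?g p = (\<Sum>j\<in>insert None (Some ` I). t j * ?f j p)"
  proof (rule farkas[where I = "insert None (Some ` I)" and f = ?f and g = ?g])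
    show "linear (?f j)" for j
      by (cases j) (auto intro!: linearI simp: algebra_simps inner_add_right inner_scaleR_right)
    show "linear ?g"
      by (auto intro!: linearI simp: algebra_simps inner_add_right)
  qed (use assms(1) nonneg in auto)
  have eq: "r * \<tau> - w \<bullet> x = t None * r + (\<Sum>i\<in>I. t (Some i) * (r * b i - a i \<bullet> x))" for x r
    using t(2)[of "(x, r)"] assms(1) by (simp add: sum.reindex)
  show thesis
  proof (rule that[of "\<lambda>i. t (Some i)"])
    have "(w - (\<Sum>i\<in>I. t (Some i) *\<^sub>R a i)) \<bullet> x = 0" for x
      using eq[of 0 x] by (simp add: inner_sum_left sum_negf inner_diff_left)
    then show "w = (\<Sum>i\<in>I. t (Some i) *\<^sub>R a i)"
      by (metis inner_eq_zero_iff eq_iff_diff_eq_0)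
    show "(\<Sum>i\<in>I. t (Some i) * b i) \<le> \<tau>"
      using eq[of 1 0] t(1)[of None] by simp
  qed (use t in auto)
qed

section \<open>Finitely generated cones\<close>

lemma convex_cone_sum:
  "convex_cone C \<Longrightarrow> (\<And>i. i \<in> I \<Longrightarrow> x i \<in> C) \<Longrightarrow> (\<Sum>i\<in>I. x i) \<in> C"
  by (induction I rule: infinite_finite_induct) (auto simp: convex_cone_contains_0 convex_cone_add)

lemma convex_cone_hull_sum:
  assumes "\<And>i. i \<in> I \<Longrightarrow> t i \<ge> 0" "\<And>i. i \<in> I \<Longrightarrow> x i \<in> convex_cone hull S"
  shows "(\<Sum>i\<in>I. t i *\<^sub>R x i) \<in> convex_cone hull S"
  using assms by (intro convex_cone_sum convex_cone_hull_mul) (auto simp: convex_cone_convex_cone_hull)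

lemma convex_coneI:
  assumes "0 \<in> C" "\<And>x y. x \<in> C \<Longrightarrow> y \<in> C \<Longrightarrow> x + y \<in> C" "\<And>c x. 0 \<le> c \<Longrightarrow> x \<in> C \<Longrightarrow> c *\<^sub>R x \<in> C"
  shows "convex_cone C"
  using assms unfolding convex_cone_def convex_def conic_def by blast

lemma convex_cone_hull_finite:
  assumes "finite S"
  shows "convex_cone hull S = {\<Sum>s\<in>S. t s *\<^sub>R s | t. \<forall>s\<in>S. 0 \<le> t s}" (is "_ = ?C")
proof
  have "convex_cone ?C"
  proof (rule convex_coneI)
    have "0 = (\<Sum>s\<in>S. 0 *\<^sub>R s)" "\<forall>s\<in>S. (0::real) \<le> 0" by auto
    then show "0 \<in> ?C" by (auto intro!: exI[of _ "\<lambda>_. 0"])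
    show "x + y \<in> ?C" if xy: "x \<in> ?C" "y \<in> ?C" for x y
    proof -
      obtain t u where "x = (\<Sum>s\<in>S. t s *\<^sub>R s)" "\<forall>s\<in>S. 0 \<le> t s" "y = (\<Sum>s\<in>S. u s *\<^sub>R s)" "\<forall>s\<in>S. 0 \<le> u s"
        using xy by blast
      then have "x + y = (\<Sum>s\<in>S. (t s + u s) *\<^sub>R s)" "\<forall>s\<in>S. 0 \<le> t s + u s"
        by (auto simp: scaleR_add_left sum.distrib)
      then show ?thesis by (intro CollectI exI[of _ "\<lambda>s. t s + u s"] conjI)
    qed
    show "c *\<^sub>R x \<in> ?C" if cx: "0 \<le> c" "x \<in> ?C" for c x
    proof -
      obtain t where "x = (\<Sum>s\<in>S. t s *\<^sub>R s)" "\<forall>s\<in>S. 0 \<le> t s"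
        using cx by blast
      then have "c *\<^sub>R x = (\<Sum>s\<in>S. (c * t s) *\<^sub>R s)" "\<forall>s\<in>S. 0 \<le> c * t s"
        using cx by (auto simp: scaleR_sum_right)
      then show ?thesis by (intro CollectI exI[of _ "\<lambda>s. c * t s"] conjI)
    qed
  qed
  moreover have "S \<subseteq> ?C"
  proof
    fix s assume "s \<in> S"
    then have "s = (\<Sum>u\<in>S. (if u = s then 1 else 0) *\<^sub>R u)"
      using assms by (simp add: if_distrib[of "\<lambda>r. r *\<^sub>R _"] sum.delta cong: if_cong)
    moreover have "\<forall>u\<in>S. (0::real) \<le> (if u = s then 1 else 0)" by simp
    ultimately show "s \<in> ?C"
      by (intro CollectI exI[of _ "\<lambda>u. if u = s then 1 else 0"] conjI)
  qed
  ultimately show "convex_cone hull S \<subseteq> ?C"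
    by (simp add: hull_minimal)
  show "?C \<subseteq> convex_cone hull S"
    by (auto intro!: convex_cone_hull_sum intro: hull_inc)
qed

text \<open>One elimination step of the double description method: generators on the hyperplane are
  kept, and each pair on opposite sides contributes the combination on which \<open>h\<close>
  vanishes.\<close>

lemma convex_cone_hull_Int_hyperplane:
  fixes h :: "'v::real_vector \<Rightarrow> real"
  assumes "finite S" "linear h"
  obtains T where "finite T" "convex_cone hull T = convex_cone hull S \<inter> {x. h x = 0}"
proof -
  define P where "P = {s\<in>S. h s > 0}"
  define N where "N = {s\<in>S. h s < 0}"
  define Z where "Z = {s\<in>S. h s = 0}"
  define T where "T = Z \<union> (\<lambda>(p, q). h p *\<^sub>R q - h q *\<^sub>R p) ` (P \<times> N)"
  have fin: "finite P" "finite N" "finite Z" "finite T"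
    using assms(1) by (auto simp: P_def N_def Z_def T_def)
  have S: "S = P \<union> N \<union> Z" "P \<inter> N = {}" "(P \<union> N) \<inter> Z = {}"
    by (auto simp: P_def N_def Z_def)
  have split: "(\<Sum>s\<in>S. f s) = (\<Sum>s\<in>P. f s) + (\<Sum>s\<in>N. f s) + (\<Sum>s\<in>Z. f s)" for f :: "'v \<Rightarrow> 'w::comm_monoid_add"
    using S fin by (simp add: sum.union_disjoint)
  have "convex_cone {x. h x = 0}"
    using assms(2) by (intro convex_coneI) (auto simp: linear_0 linear_add linear_cmul)
  then have "convex_cone (convex_cone hull S \<inter> {x. h x = 0})"
    using convex_cone_Inter[of "{convex_cone hull S, {x. h x = 0}}"] convex_cone_convex_cone_hull by auto
  moreover have "T \<subseteq> convex_cone hull S \<inter> {x. h x = 0}"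
  proof
    fix x assume "x \<in> T"
    then consider "x \<in> Z" | p q where "p \<in> P" "q \<in> N" "x = h p *\<^sub>R q - h q *\<^sub>R p"
      by (auto simp: T_def)
    then show "x \<in> convex_cone hull S \<inter> {x. h x = 0}"
    proof cases
      case 1
      then show ?thesis by (auto simp: Z_def hull_inc)
    next
      case 2
      then have "h p *\<^sub>R q + (- h q) *\<^sub>R p \<in> convex_cone hull S"
        by (intro convex_cone_hull_add convex_cone_hull_mul hull_inc) (auto simp: P_def N_def)
      then show ?thesis
        using 2 assms(2) by (simp add: linear_diff linear_cmul)
    qed
  qed
  ultimately have sub: "convex_cone hull T \<subseteq> convex_cone hull S \<inter> {x. h x = 0}"
    by (rule hull_minimal[rotated])
  have "x \<in> convex_cone hull T" if x: "x \<in> convex_cone hull S" "h x = 0" for x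
  proof -
    obtain t where t: "x = (\<Sum>s\<in>S. t s *\<^sub>R s)" "\<forall>s\<in>S. 0 \<le> t s"
      using x(1) assms(1) by (auto simp: convex_cone_hull_finite)
    \<comment> \<open>The total positive weight of \<open>h\<close> in the combination; as
      \<open>h x = 0\<close>, the negative weight has the same size.\<close>
    define m where "m = (\<Sum>p\<in>P. t p * h p)"
    have "0 = (\<Sum>s\<in>S. t s * h s)"
      using x(2) assms(2) by (simp add: t(1) linear_sum linear_cmul)
    also have "\<dots> = m + (\<Sum>q\<in>N. t q * h q)"
      unfolding split by (auto simp: m_def Z_def)
    finally have mN: "m = (\<Sum>q\<in>N. t q * - h q)" by (simp add: sum_negf)
    have Zin: "(\<Sum>s\<in>Z. t s *\<^sub>R s) \<in> convex_cone hull T"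
      using t by (intro convex_cone_hull_sum hull_inc) (auto simp: Z_def T_def)
    have PN: "(\<Sum>p\<in>P. t p *\<^sub>R p) + (\<Sum>q\<in>N. t q *\<^sub>R q) \<in> convex_cone hull T"
    proof (cases "m = 0")
      case True
      have "\<forall>p\<in>P. t p * h p = 0"
        using True t fin(1) unfolding m_def
        by (subst (asm) sum_nonneg_eq_0_iff) (auto simp: P_def)
      moreover have "\<forall>q\<in>N. t q * - h q = 0"
        using True t fin(2) unfolding mN
        by (subst (asm) sum_nonneg_eq_0_iff) (auto simp: N_def mult_nonneg_nonpos)
      ultimately have "t s = 0" if "s \<in> P \<union> N" for s
        using that by (auto simp: P_def N_def)
      then show ?thesis
        by (simp add: convex_cone_hull_contains_0)
    next
      case False
      have "m \<ge> 0" using t unfolding m_def by (auto intro!: sum_nonneg simp: P_def)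
      \<comment> \<open>A transport plan: \<open>t p * h p\<close> sums to \<open>m\<close> over
        \<open>P\<close> and \<open>t q * - h q\<close> sums to \<open>m\<close> over
        \<open>N\<close>, so the weights \<open>t p * t q / m\<close> on pairs reproduce exactly the
        part of \<open>x\<close> off the hyperplane.\<close>
      have "(\<Sum>(p, q)\<in>P \<times> N. (t p * t q / m) *\<^sub>R (h p *\<^sub>R q - h q *\<^sub>R p)) \<in> convex_cone hull T"
        using t \<open>m \<ge> 0\<close> unfolding split_beta
        by (intro convex_cone_hull_sum hull_inc) (auto simp: P_def N_def T_def)
      also have "(\<Sum>(p, q)\<in>P \<times> N. (t p * t q / m) *\<^sub>R (h p *\<^sub>R q - h q *\<^sub>R p))
          = (\<Sum>p\<in>P. \<Sum>q\<in>N. (t p * h p / m) *\<^sub>R (t q *\<^sub>R q)) + (\<Sum>p\<in>P. \<Sum>q\<in>N. (t q * - h q / m) *\<^sub>R (t p *\<^sub>R p))"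
        unfolding sum.cartesian_product sum.distrib[symmetric]
        by (intro sum.cong) (auto simp: algebra_simps)
      also have "(\<Sum>p\<in>P. \<Sum>q\<in>N. (t p * h p / m) *\<^sub>R (t q *\<^sub>R q)) = (\<Sum>p\<in>P. t p * h p / m) *\<^sub>R (\<Sum>q\<in>N. t q *\<^sub>R q)"
        by (subst sum.swap) (simp only: scaleR_sum_left scaleR_sum_right)
      also have "(\<Sum>p\<in>P. t p * h p / m) = 1"
        using False by (simp add: sum_divide_distrib[symmetric] m_def[symmetric])
      also have "(\<Sum>p\<in>P. \<Sum>q\<in>N. (t q * - h q / m) *\<^sub>R (t p *\<^sub>R p)) = (\<Sum>q\<in>N. t q * - h q / m) *\<^sub>R (\<Sum>p\<in>P. t p *\<^sub>R p)"
        by (simp only: scaleR_sum_left scaleR_sum_right)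
      also have "(\<Sum>q\<in>N. t q * - h q / m) = 1"
        using False by (simp only: sum_divide_distrib[symmetric] mN[symmetric]) simp
      finally show ?thesis by (simp add: add.commute)
    qed
    show ?thesis
      unfolding t(1) split by (rule convex_cone_hull_add[OF PN Zin])
  qed
  then have "convex_cone hull T = convex_cone hull S \<inter> {x. h x = 0}"
    using sub by blast
  then show thesis using that fin(4) by blast
qed

lemma convex_cone_hull_Int_kernels:
  fixes h :: "'i \<Rightarrow> 'v::real_vector \<Rightarrow> real"
  assumes "finite S" "finite I" "\<And>i. i \<in> I \<Longrightarrow> linear (h i)"
  shows "\<exists>T. finite T \<and> convex_cone hull T = convex_cone hull S \<inter> {x. \<forall>i\<in>I. h i x = 0}"
  using assms(2,3)
proof (induction I rule: finite_induct)
  case empty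
  then show ?case using assms(1) by auto
next
  case (insert i I)
  then obtain T where T: "finite T" "convex_cone hull T = convex_cone hull S \<inter> {x. \<forall>i\<in>I. h i x = 0}"
    by auto
  obtain U where "finite U" "convex_cone hull U = convex_cone hull T \<inter> {x. h i x = 0}"
    using convex_cone_hull_Int_hyperplane[OF T(1)] insert.prems by (metis insertI1)
  then show ?case using T by (intro exI[of _ U]) auto
qed

section \<open>Extreme rays\<close>

lemma ray_eq: "ray p = {t *\<^sub>R p | t. t \<ge> 0}"
  by (auto simp: ray_def scaleR_prod_def scaleR_fun_def)

lemma extreme_ray_iff:
  "extreme_ray G p \<longleftrightarrow> p \<noteq> 0 \<and> p \<in> G \<and> (\<forall>x\<in>G. \<forall>y\<in>G. x + y \<in> ray p \<longrightarrow> x \<in> ray p \<and> y \<in> ray p)"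
  by (simp add: extreme_ray_def zero_prod_def plus_prod_def zero_fun_def plus_fun_def)

text \<open>Together with the next lemma this links the explicit finite combinations of
  \<open>cone_hull\<close> to \<open>convex_cone hull\<close>, for which monotonicity and minimality
  arguments are available.\<close>

lemma cone_hull_subset:
  assumes "S \<subseteq> convex_cone hull T"
  shows "cone_hull S \<subseteq> convex_cone hull T"
proof
  fix p assume "p \<in> cone_hull S"
  then obtain F t where F: "finite F" "F \<subseteq> S" "\<forall>s\<in>F. t s \<ge> 0"
    "p = ((\<lambda>\<alpha>. \<Sum>s\<in>F. t s * fst s \<alpha>), (\<Sum>s\<in>F. t s * snd s))"
    unfolding cone_hull_def by blast
  then have "p = (\<Sum>s\<in>F. t s *\<^sub>R s)"
    by (auto simp: prod_eq_iff fst_sum snd_sum sum_fun_apply fun_eq_iff)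
  then show "p \<in> convex_cone hull T"
    using F assms by (auto intro!: convex_cone_hull_sum)
qed

lemma convex_cone_hull_subset_cone_hull:
  assumes "finite T" "T \<subseteq> S"
  shows "convex_cone hull T \<subseteq> cone_hull S"
proof
  fix p assume "p \<in> convex_cone hull T"
  then obtain t where t: "p = (\<Sum>s\<in>T. t s *\<^sub>R s)" "\<forall>s\<in>T. 0 \<le> t s"
    using assms by (auto simp: convex_cone_hull_finite)
  then have "p = ((\<lambda>\<alpha>. \<Sum>s\<in>T. t s * fst s \<alpha>), (\<Sum>s\<in>T. t s * snd s))"
    by (auto simp: prod_eq_iff fst_sum snd_sum sum_fun_apply fun_eq_iff)
  then show "p \<in> cone_hull S"
    unfolding cone_hull_def using t assms by blast
qed

text \<open>Some term in a representation of \<open>p\<close> is nonzero; it and the rest add up to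
  \<open>p\<close>, so extremality puts it on the ray.\<close>

lemma extreme_ray_multiple_of_generator:
  assumes "extreme_ray (convex_cone hull S) p" "finite S"
  obtains s k where "s \<in> S" "k > 0" "s = k *\<^sub>R p"
proof -
  have p: "p \<noteq> 0" "p \<in> convex_cone hull S"
    using assms(1) by (auto simp: extreme_ray_iff)
  then obtain t where t: "p = (\<Sum>s\<in>S. t s *\<^sub>R s)" "\<forall>s\<in>S. 0 \<le> t s"
    using assms by (auto simp: convex_cone_hull_finite)
  then obtain s where s: "s \<in> S" "t s *\<^sub>R s \<noteq> 0"
    using p(1) by (metis (no_types, lifting) sum.neutral)
  have "t s *\<^sub>R s + (\<Sum>u\<in>S - {s}. t u *\<^sub>R u) = p"
    using t(1) s(1) assms(2) by (simp add: sum.remove)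
  then have "t s *\<^sub>R s + (\<Sum>u\<in>S - {s}. t u *\<^sub>R u) \<in> ray p"
    by (auto simp: ray_eq intro: exI[of _ 1])
  moreover have "t s *\<^sub>R s \<in> convex_cone hull S" "(\<Sum>u\<in>S - {s}. t u *\<^sub>R u) \<in> convex_cone hull S"
    using s t by (auto intro!: convex_cone_hull_sum convex_cone_hull_mul intro: hull_inc)
  ultimately have "t s *\<^sub>R s \<in> ray p"
    using assms(1) unfolding extreme_ray_iff by blast
  then obtain k where k: "t s *\<^sub>R s = k *\<^sub>R p" "k \<ge> 0" by (auto simp: ray_eq)
  have ts: "t s > 0" "k \<noteq> 0" using s t k by (auto simp: less_le)
  have "s = (k / t s) *\<^sub>R p"
  proof -
    have "s = (1 / t s) *\<^sub>R (t s *\<^sub>R s)" using ts by simp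
    then show ?thesis by (simp add: k)
  qed
  then show thesis using that[of s "k / t s"] s ts k by auto
qed

text \<open>A generating subset of least cardinality has no element generated by the others, and
  pointedness then makes each element extreme. Pointedness is stated through coefficients, which
  also keeps 0 out of \<open>S\<close>.\<close>

lemma convex_cone_hull_extreme_generators:
  assumes "finite S"
    and pointed: "\<And>a. (\<And>s. s \<in> S \<Longrightarrow> a s \<ge> 0) \<Longrightarrow> (\<Sum>s\<in>S. a s *\<^sub>R s) = 0 \<Longrightarrow> \<forall>s\<in>S. a s = 0"
  shows "convex_cone hull {s \<in> S. extreme_ray (convex_cone hull S) s} = convex_cone hull S"
proof -
  let ?P = "\<lambda>T. T \<subseteq> S \<and> convex_cone hull T = convex_cone hull S"
  obtain T where T: "T \<subseteq> S" "convex_cone hull T = convex_cone hull S"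
    and min: "\<And>U. U \<subseteq> S \<Longrightarrow> convex_cone hull U = convex_cone hull S \<Longrightarrow> card T \<le> card U"
    using ex_has_least_nat[of ?P S card] by auto
  have finT: "finite T" using T(1) assms(1) finite_subset by blast
  have indep: "t \<notin> convex_cone hull (T - {t})" if "t \<in> T" for t
  proof
    assume "t \<in> convex_cone hull (T - {t})"
    then have "T \<subseteq> convex_cone hull (T - {t})"
      by (metis Diff_iff hull_inc insertE insert_Diff subsetI that)
    then have "convex_cone hull T = convex_cone hull (T - {t})"
      by (simp add: Diff_subset hull_mono hull_minimal convex_cone_convex_cone_hull subset_antisym)
    then have "card T \<le> card (T - {t})"
      using min[of "T - {t}"] T by auto
    then show False using that finT by (metis card_Diff1_less linorder_not_less)
  qed
  have pT: "\<forall>s\<in>T. a s = 0" if "\<And>s. s \<in> T \<Longrightarrow> a s \<ge> 0" "(\<Sum>s\<in>T. a s *\<^sub>R s) = 0" for a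
  proof -
    let ?b = "\<lambda>s. if s \<in> T then a s else 0"
    have "(\<Sum>s\<in>S. ?b s *\<^sub>R s) = (\<Sum>s\<in>T. ?b s *\<^sub>R s)"
      using T(1) assms(1) by (intro sum.mono_neutral_right) auto
    also have "\<dots> = 0" using that(2) by simp
    finally have "\<forall>s\<in>S. ?b s = 0"
      using that(1) by (intro pointed) auto
    then show ?thesis using T(1) by (metis subsetD)
  qed
  have "extreme_ray (convex_cone hull S) t" if t: "t \<in> T" for t
    unfolding extreme_ray_iff
  proof (intro conjI ballI impI)
    show "t \<noteq> 0" using indep[OF t] convex_cone_hull_contains_0 by metis
    show "t \<in> convex_cone hull S" using T t by (metis hull_inc)
    fix x y assume xy: "x \<in> convex_cone hull S" "y \<in> convex_cone hull S" "x + y \<in> ray t"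
    obtain a where a: "x = (\<Sum>s\<in>T. a s *\<^sub>R s)" "\<forall>s\<in>T. 0 \<le> a s"
      using xy(1) finT unfolding T(2)[symmetric] by (auto simp: convex_cone_hull_finite)
    obtain b where b: "y = (\<Sum>s\<in>T. b s *\<^sub>R s)" "\<forall>s\<in>T. 0 \<le> b s"
      using xy(2) finT unfolding T(2)[symmetric] by (auto simp: convex_cone_hull_finite)
    obtain k where k: "x + y = k *\<^sub>R t" "k \<ge> 0" using xy(3) by (auto simp: ray_eq)
    \<comment> \<open>Coefficients of the relation \<open>x + y - k *\<^sub>R t = 0\<close>. Only
      the one at \<open>t\<close> could be negative, and then \<open>t\<close> would be generated by
      the others; so all are nonnegative and pointedness makes them vanish.\<close>
    define c where "c = (\<lambda>s. a s + b s - (if s = t then k else 0))"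
    have xa: "x = a t *\<^sub>R t + (\<Sum>s\<in>T-{t}. a s *\<^sub>R s)" and yb: "y = b t *\<^sub>R t + (\<Sum>s\<in>T-{t}. b s *\<^sub>R s)"
      using a(1) b(1) finT t by (simp_all add: sum.remove)
    have rest: "(\<Sum>s\<in>T-{t}. a s *\<^sub>R s) + (\<Sum>s\<in>T-{t}. b s *\<^sub>R s) = (\<Sum>s\<in>T-{t}. c s *\<^sub>R s)"
      unfolding sum.distrib[symmetric] by (intro sum.cong) (auto simp: c_def scaleR_add_left)
    have c0: "c t *\<^sub>R t + (\<Sum>s\<in>T-{t}. c s *\<^sub>R s) = 0"
      unfolding rest[symmetric] using k(1) xa yb by (simp add: c_def algebra_simps)
    have cn: "c s \<ge> 0" if "s \<in> T - {t}" for s using a b that by (auto simp: c_def)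
    have "c t \<ge> 0"
    proof (rule ccontr)
      assume neg: "\<not> c t \<ge> 0"
      have "(\<Sum>s\<in>T-{t}. c s *\<^sub>R s) = (- c t) *\<^sub>R t"
        using c0 by (simp add: add_eq_0_iff)
      then have "t = (1 / - c t) *\<^sub>R (\<Sum>s\<in>T-{t}. c s *\<^sub>R s)"
        using neg by (simp only:) simp
      moreover have "(1 / - c t) *\<^sub>R (\<Sum>s\<in>T-{t}. c s *\<^sub>R s) \<in> convex_cone hull (T - {t})"
        using neg cn by (intro convex_cone_hull_mul convex_cone_hull_sum hull_inc) auto
      ultimately show False using indep[OF t] by simp
    qed
    then have "\<forall>s\<in>T. c s = 0"
      using cn c0 finT t by (intro pT) (auto simp: sum.remove[of T t])
    then have "a s + b s = 0 \<and> a s \<ge> 0 \<and> b s \<ge> 0" if "s \<in> T - {t}" for s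
      using that a(2) b(2) by (auto simp: c_def)
    then have "a s = 0 \<and> b s = 0" if "s \<in> T - {t}" for s
      using that by (metis add_nonneg_eq_0_iff)
    then have "x = a t *\<^sub>R t" "y = b t *\<^sub>R t"
      unfolding xa yb by auto
    then show "x \<in> ray t" "y \<in> ray t"
      using a(2) b(2) t by (auto simp: ray_eq)
  qed
  then have "T \<subseteq> {s \<in> S. extreme_ray (convex_cone hull S) s}" using T(1) by auto
  then have "convex_cone hull T \<subseteq> convex_cone hull {s \<in> S. extreme_ray (convex_cone hull S) s}"
    by (rule hull_mono)
  moreover have "convex_cone hull {s \<in> S. extreme_ray (convex_cone hull S) s} \<subseteq> convex_cone hull S"
    by (intro hull_mono) auto
  ultimately show ?thesis unfolding T(2) by (rule subset_antisym[rotated])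
qed

section \<open>Half-space descriptions and rescaling of rays\<close>

lemma polyhedron_inequalities:
  fixes X :: "'a::euclidean_space set"
  assumes "polyhedron X"
  obtains P :: "('a \<times> real) set" where "finite P" "X = {x. \<forall>p\<in>P. fst p \<bullet> x \<le> snd p}"
proof -
  obtain F where F: "finite F" "X = \<Inter>F" "\<forall>h\<in>F. \<exists>a b. a \<noteq> 0 \<and> h = {x. a \<bullet> x \<le> b}"
    using assms unfolding polyhedron_def by blast
  then obtain a b where ab: "\<And>h. h \<in> F \<Longrightarrow> h = {x. a h \<bullet> x \<le> b h}"
    by metis
  have "X = {x. \<forall>h\<in>F. a h \<bullet> x \<le> b h}"
    using F(2) ab by blast
  then show thesis
    using F(1) by (intro that[of "(\<lambda>h. (a h, b h)) ` F"]) auto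
qed

lemma ray_self: "p \<in> ray p"
  by (auto simp: ray_eq intro: exI[of _ 1])

lemma ray_scaleR: "k > 0 \<Longrightarrow> ray (k *\<^sub>R p) = ray p"
proof (intro set_eqI iffI)
  fix x assume k: "k > 0"
  show "x \<in> ray p" if "x \<in> ray (k *\<^sub>R p)"
    using that k by (auto simp: ray_eq intro: exI[of _ "_ * k"])
  show "x \<in> ray (k *\<^sub>R p)" if "x \<in> ray p"
  proof -
    obtain t where "x = t *\<^sub>R p" "t \<ge> 0" using \<open>x \<in> ray p\<close> by (auto simp: ray_eq)
    then have "x = (t / k) *\<^sub>R (k *\<^sub>R p)" "t / k \<ge> 0" using k by auto
    then show ?thesis unfolding ray_eq by blast
  qed
qed

lemma extreme_ray_scaleR:
  assumes "extreme_ray G p" "k > 0" "convex_cone G"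
  shows "extreme_ray G (k *\<^sub>R p)"
  using assms by (auto simp: extreme_ray_iff ray_scaleR convex_cone_scaleR)

lemma convex_cone_hull_Diff_zero: "convex_cone hull (S - {0}) = convex_cone hull S"
proof
  show "convex_cone hull (S - {0}) \<subseteq> convex_cone hull S"
    by (intro hull_mono) auto
  have "S \<subseteq> convex_cone hull (S - {0})"
    using convex_cone_hull_contains_0 by (auto intro: hull_inc)
  then show "convex_cone hull S \<subseteq> convex_cone hull (S - {0})"
    by (intro hull_minimal convex_cone_convex_cone_hull)
qed

section \<open>Support functions and circuits\<close>

lemma supp_fun_le_iff: "supp_fun X w \<le> ereal \<tau> \<longleftrightarrow> (\<forall>x\<in>X. w \<bullet> x \<le> \<tau>)"
  by (simp add: supp_fun_def SUP_le_iff)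

lemma supp_fun_real:
  assumes "X \<noteq> {}" "supp_fun X w < \<infinity>"
  shows "supp_fun X w = ereal (real_of_ereal (supp_fun X w))"
proof -
  obtain x where "x \<in> X" using assms(1) by auto
  then have "ereal (w \<bullet> x) \<le> supp_fun X w"
    unfolding supp_fun_def by (rule SUP_upper)
  then show ?thesis using assms(2) by (cases "supp_fun X w") auto
qed

lemma Amul_zero [simp]: "Amul A 0 = 0"
  by (simp add: Amul_def)

lemma Amul_add: "Amul A (u + v) = Amul A u + Amul A v"
  by (simp add: Amul_def scaleR_add_left sum.distrib)

lemma Amul_scaleR: "Amul A (c *\<^sub>R u) = c *\<^sub>R Amul A u"
  by (simp add: Amul_def scaleR_sum_right)

lemma Amul_inner: "Amul A u \<bullet> x = (\<Sum>\<alpha>\<in>A. u \<alpha> * (\<alpha> \<bullet> x))"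
  by (simp add: Amul_def inner_sum_left)

lemma Nbeta_zero: "0 \<in> Nbeta A \<beta>"
  by (simp add: Nbeta_def in_RA_def)

lemma Nbeta_add: "u \<in> Nbeta A \<beta> \<Longrightarrow> v \<in> Nbeta A \<beta> \<Longrightarrow> u + v \<in> Nbeta A \<beta>"
  by (auto simp: Nbeta_def in_RA_def sum.distrib)

lemma Nbeta_scaleR: "0 \<le> c \<Longrightarrow> u \<in> Nbeta A \<beta> \<Longrightarrow> c *\<^sub>R u \<in> Nbeta A \<beta>"
  by (auto simp: Nbeta_def in_RA_def sum_distrib_left[symmetric])

lemma Nbeta_neg:
  assumes "finite A" "\<beta> \<in> A" "\<nu> \<in> Nbeta A \<beta>"
  shows "\<nu> \<beta> \<le> 0" "\<nu> \<noteq> 0 \<Longrightarrow> \<nu> \<beta> < 0"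
proof -
  have sum: "\<nu> \<beta> = - (\<Sum>\<alpha>\<in>A-{\<beta>}. \<nu> \<alpha>)" and nn: "\<And>\<alpha>. \<alpha> \<in> A - {\<beta>} \<Longrightarrow> \<nu> \<alpha> \<ge> 0"
    using assms by (auto simp: Nbeta_def sum.remove)
  then show "\<nu> \<beta> \<le> 0" using sum_nonneg[of "A - {\<beta>}" \<nu>] by simp
  moreover have "\<nu> = 0" if "\<nu> \<beta> = 0"
  proof -
    have "\<forall>\<alpha>\<in>A-{\<beta>}. \<nu> \<alpha> = 0"
      using sum nn that assms(1) by (subst sum_nonneg_eq_0_iff[symmetric]) auto
    then show ?thesis
      using assms that by (fastforce simp: Nbeta_def in_RA_def)
  qed
  ultimately show "\<nu> \<noteq> 0 \<Longrightarrow> \<nu> \<beta> < 0" by fastforce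
qed

lemma circuit_entries:
  assumes "X_circuit X A \<beta> \<nu>"
  shows "\<nu> \<in> Nbeta A \<beta>" "\<nu> \<noteq> 0" "supp_fun X (- Amul A \<nu>) < \<infinity>"
  using assms by (auto simp: X_circuit_def zero_fun_def)

text \<open>The bound is imposed point by point, so no infinite values enter: for nonempty
  \<open>X\<close>, a vector of \<open>Nbeta A \<beta>\<close> occurs here exactly when its support
  value is finite.\<close>

definition support_epigraph :: "'a::euclidean_space set \<Rightarrow> 'a set \<Rightarrow> 'a \<Rightarrow> (('a \<Rightarrow> real) \<times> real) set" where
  "support_epigraph X A \<beta> = {(\<nu>, \<tau>). \<nu> \<in> Nbeta A \<beta> \<and> (\<forall>x\<in>X. - Amul A \<nu> \<bullet> x \<le> \<tau>)}"

text \<open>If \<alpha> - \<beta> had a constant value \<open>k\<close> on \<open>X\<close>, the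
  exponential of \<alpha> would be \<open>exp k\<close> times that of \<beta> there, a nontrivial
  linear relation.\<close>

lemma exponentials_separated:
  assumes "exp_lin_indep_on X A" "finite A" "\<alpha> \<in> A" "\<beta> \<in> A" "\<alpha> \<noteq> \<beta>"
  obtains x x' where "x \<in> X" "x' \<in> X" "(\<alpha> - \<beta>) \<bullet> (x - x') \<noteq> 0"
proof (rule ccontr)
  assume "\<not> thesis"
  then have const: "(\<alpha> - \<beta>) \<bullet> x = (\<alpha> - \<beta>) \<bullet> x'" if "x \<in> X" "x' \<in> X" for x x'
    using that \<open>\<And>x' x. \<lbrakk>x \<in> X; x' \<in> X; (\<alpha> - \<beta>) \<bullet> (x - x') \<noteq> 0\<rbrakk> \<Longrightarrow> thesis\<close>
    by (metis eq_iff_diff_eq_0 inner_diff_right)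
  obtain k where k: "\<And>x. x \<in> X \<Longrightarrow> (\<alpha> - \<beta>) \<bullet> x = k"
    using const by metis
  define c where "c = (\<lambda>\<gamma>. if \<gamma> = \<alpha> then 1 else if \<gamma> = \<beta> then - exp k else 0)"
  have "(\<Sum>\<gamma>\<in>A. c \<gamma> * exp (\<gamma> \<bullet> x)) = 0" if "x \<in> X" for x
  proof -
    have "(\<Sum>\<gamma>\<in>A. c \<gamma> * exp (\<gamma> \<bullet> x)) = (\<Sum>\<gamma>\<in>{\<alpha>, \<beta>}. c \<gamma> * exp (\<gamma> \<bullet> x))"
      using assms by (intro sum.mono_neutral_right) (auto simp: c_def)
    also have "\<dots> = exp (\<alpha> \<bullet> x) - exp (k + \<beta> \<bullet> x)"
      using assms(5) by (simp add: c_def exp_add)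
    also have "k + \<beta> \<bullet> x = \<alpha> \<bullet> x"
      using k[OF that] by (simp add: inner_diff_left)
    finally show ?thesis by simp
  qed
  then have "c \<alpha> = 0"
    using assms unfolding exp_lin_indep_on_def by blast
  then show False by (simp add: c_def)
qed

section \<open>Epigraphs of support functions and the circuit graph\<close>

locale polyhedral_signomials =
  fixes X :: "'a::euclidean_space set" and A :: "'a set"
  assumes polyhedron: "polyhedron X" and nonempty: "X \<noteq> {}" and finite: "finite A"
    and indep: "exp_lin_indep_on X A"
begin

abbreviation "epi \<equiv> support_epigraph X A"

text \<open>Meaningful only where the support function is finite, because
  \<open>real_of_ereal\<close> sends infinite values to 0; membership in an epigraph guarantees
  finiteness.\<close>

definition sig :: "('a \<Rightarrow> real) \<Rightarrow> real" where
  "sig \<nu> = real_of_ereal (supp_fun X (- Amul A \<nu>))"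

lemma funform_eq: "funform X A \<nu> = (\<nu>, sig \<nu>)"
  by (simp add: funform_def sig_def)

lemma convex_cone_epi: "convex_cone (epi \<beta>)"
proof (rule convex_coneI)
  show "0 \<in> epi \<beta>"
    by (simp add: support_epigraph_def zero_prod_def Nbeta_zero)
  show "p + q \<in> epi \<beta>" if "p \<in> epi \<beta>" "q \<in> epi \<beta>" for p q
    using that by (fastforce simp: support_epigraph_def Nbeta_add Amul_add inner_add_left)
  show "c *\<^sub>R p \<in> epi \<beta>" if "0 \<le> c" "p \<in> epi \<beta>" for c p
  proof -
    obtain \<nu> \<tau> where p: "p = (\<nu>, \<tau>)" by (cases p)
    have "- (Amul A (c *\<^sub>R \<nu>) \<bullet> x) \<le> c * \<tau>" if "x \<in> X" for x
      using mult_left_mono[of "- (Amul A \<nu> \<bullet> x)" \<tau> c] \<open>p \<in> epi \<beta>\<close> \<open>0 \<le> c\<close> that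
      by (auto simp: support_epigraph_def p Amul_scaleR)
    then show ?thesis
      using that by (auto simp: support_epigraph_def p Nbeta_scaleR)
  qed
qed

lemma epi_sig:
  assumes "(\<nu>, \<tau>) \<in> epi \<beta>"
  shows "supp_fun X (- Amul A \<nu>) = ereal (sig \<nu>)" "sig \<nu> \<le> \<tau>" "(\<nu>, sig \<nu>) \<in> epi \<beta>"
proof -
  have le: "supp_fun X (- Amul A \<nu>) \<le> ereal \<tau>"
    using assms by (simp add: supp_fun_le_iff support_epigraph_def)
  then have "supp_fun X (- Amul A \<nu>) < \<infinity>"
    by (rule le_less_trans) simp
  then show eq: "supp_fun X (- Amul A \<nu>) = ereal (sig \<nu>)"
    unfolding sig_def by (rule supp_fun_real[OF nonempty])
  show "sig \<nu> \<le> \<tau>" using le eq by simp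
  have "\<forall>x\<in>X. - Amul A \<nu> \<bullet> x \<le> sig \<nu>"
    using eq supp_fun_le_iff[of X "- Amul A \<nu>" "sig \<nu>"] by simp
  then show "(\<nu>, sig \<nu>) \<in> epi \<beta>"
    using assms by (simp add: support_epigraph_def)
qed

lemma funform_in_epi:
  assumes "\<nu> \<in> Nbeta A \<beta>" "supp_fun X (- Amul A \<nu>) < \<infinity>"
  shows "funform X A \<nu> \<in> epi \<beta>"
proof -
  have "supp_fun X (- Amul A \<nu>) = ereal (sig \<nu>)"
    unfolding sig_def by (rule supp_fun_real[OF nonempty assms(2)])
  then have "\<forall>x\<in>X. - Amul A \<nu> \<bullet> x \<le> sig \<nu>"
    using supp_fun_le_iff[of X "- Amul A \<nu>" "sig \<nu>"] by simp
  then show ?thesis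
    using assms by (simp add: support_epigraph_def funform_eq)
qed

text \<open>The constraint \<open>\<tau> \<ge> \<sigma>\<^sub>X(- A \<nu>)\<close> holds iff \<open>- A \<nu>\<close> is a nonnegative combination of the normals
  of \<open>X\<close> with offset at most \<open>\<tau>\<close>. So the epigraph is a linear image of the section \<open>z = 0\<close> of a
  finitely generated cone of triples \<open>((\<nu>, \<tau>), z)\<close>.\<close>

lemma epi_finitely_generated:
  assumes "\<beta> \<in> A"
  obtains S where "finite S" "convex_cone hull S = epi \<beta>"
proof -
  obtain P where P: "finite P" "X = {x. \<forall>p\<in>P. fst p \<bullet> x \<le> snd p}"
    using polyhedron_inequalities[OF polyhedron] by blast
  define e :: "'a \<Rightarrow> 'a \<Rightarrow> real" where "e = (\<lambda>\<alpha> \<gamma>. if \<gamma> = \<alpha> then 1 else 0)"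
  have Amul_e: "Amul A (e \<alpha>) = \<alpha>" if "\<alpha> \<in> A" for \<alpha>
    using that finite by (simp add: Amul_def e_def if_distrib[of "\<lambda>r. r *\<^sub>R _"] sum.delta cong: if_cong)
  have Amul_diff: "Amul A (u - v) = Amul A u - Amul A v" for u v
    by (simp add: Amul_def scaleR_diff_left sum_subtractf)
  \<comment> \<open>\<open>g1\<close> generates \<open>Nbeta A \<beta>\<close> at height 0 and
    records \<open>Amul\<close> in the last coordinate; \<open>g2\<close> adds a normal of
    \<open>X\<close> there and its offset to the height. A vanishing last coordinate says that minus
    \<open>Amul\<close> is the combination of normals in use.\<close>
  define g1 where "g1 = (\<lambda>\<alpha>. ((e \<alpha> - e \<beta>, 0 :: real), \<alpha> - \<beta>))"
  define g2 where "g2 = (\<lambda>p. ((0 :: 'a \<Rightarrow> real, snd p :: real), fst p :: 'a))"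
  define U where "U = g1 ` (A - {\<beta>}) \<union> g2 ` P \<union> {((0, 1), 0)}"
  define K :: "((('a \<Rightarrow> real) \<times> real) \<times> 'a) set" where "K = {w. \<forall>b\<in>Basis. snd w \<bullet> b = 0}"
  have K: "w \<in> K \<longleftrightarrow> snd w = 0" for w :: "(('a \<Rightarrow> real) \<times> real) \<times> 'a"
    by (auto simp: K_def euclidean_all_zero_iff)
  obtain T where T: "finite T" "convex_cone hull T = convex_cone hull U \<inter> K"
    using convex_cone_hull_Int_kernels[of U Basis "\<lambda>b w. (snd w :: 'a) \<bullet> b"] P(1) finite
    unfolding K_def U_def
    by (force intro!: linearI simp: inner_add_left)
  \<comment> \<open>This condition holds on all generators and, where the last coordinate is 0, is
    the one defining the epigraph; it yields one inclusion.\<close>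
  define C where "C = {w. fst (fst w) \<in> Nbeta A \<beta> \<and> (\<forall>x\<in>X. (snd w - Amul A (fst (fst w))) \<bullet> x \<le> snd (fst w))}"
  have "convex_cone C"
  proof (rule convex_coneI)
    show "0 \<in> C" by (simp add: C_def Nbeta_zero)
    show "v + w \<in> C" if "v \<in> C" "w \<in> C" for v w
    proof -
      have "(snd v + snd w - (Amul A (fst (fst v)) + Amul A (fst (fst w)))) \<bullet> x \<le> snd (fst v) + snd (fst w)" if "x \<in> X" for x
        using \<open>v \<in> C\<close> \<open>w \<in> C\<close> that by (fastforce simp: C_def algebra_simps)
      then show ?thesis using that by (auto simp: C_def Nbeta_add Amul_add)
    qed
    show "c *\<^sub>R w \<in> C" if "0 \<le> c" "w \<in> C" for c w
    proof -
      have "(c *\<^sub>R snd w - c *\<^sub>R Amul A (fst (fst w))) \<bullet> x \<le> c * snd (fst w)" if "x \<in> X" for x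
        using \<open>w \<in> C\<close> that mult_left_mono[of _ _ c] \<open>0 \<le> c\<close>
        unfolding C_def scaleR_diff_right[symmetric] inner_scaleR_left by blast
      then show ?thesis using that by (auto simp: C_def Nbeta_scaleR Amul_scaleR)
    qed
  qed
  moreover have "U \<subseteq> C"
  proof -
    have "e \<alpha> - e \<beta> \<in> Nbeta A \<beta>" if "\<alpha> \<in> A" for \<alpha>
      using that assms finite by (auto simp: Nbeta_def in_RA_def e_def sum_subtractf)
    then show ?thesis
      using assms by (auto simp: U_def C_def g1_def g2_def Amul_diff Amul_e Nbeta_zero P(2))
  qed
  ultimately have UC: "convex_cone hull U \<subseteq> C" by (simp add: hull_minimal)
  have "fst ` (convex_cone hull T) = epi \<beta>"
  proof (intro set_eqI iffI)
    fix p assume "p \<in> fst ` (convex_cone hull T)"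
    then obtain w where "w \<in> C" "snd w = 0" "p = fst w"
      using T(2) UC K by auto
    then show "p \<in> epi \<beta>" by (auto simp: C_def support_epigraph_def split_beta)
  next
    fix p assume "p \<in> epi \<beta>"
    then obtain \<nu> \<tau> where p: "p = (\<nu>, \<tau>)" and \<nu>: "\<nu> \<in> Nbeta A \<beta>" and le: "\<forall>x\<in>X. - Amul A \<nu> \<bullet> x \<le> \<tau>"
      by (auto simp: support_epigraph_def)
    obtain x0 where "x0 \<in> X" using nonempty by auto
    then obtain t where t: "\<And>p. p \<in> P \<Longrightarrow> t p \<ge> 0" "- Amul A \<nu> = (\<Sum>p\<in>P. t p *\<^sub>R fst p)"
        "(\<Sum>p\<in>P. t p * snd p) \<le> \<tau>"
      using farkas_affine[of P fst x0 snd "- Amul A \<nu>" \<tau>] P le by auto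
    \<comment> \<open>The lift of \<open>p\<close>: the entries of \<nu> away from \<beta>, the
      Farkas multipliers, and the slack between \<tau> and the offset that these produce.\<close>
    define w where "w = (\<Sum>\<alpha>\<in>A-{\<beta>}. \<nu> \<alpha> *\<^sub>R g1 \<alpha>) + (\<Sum>p\<in>P. t p *\<^sub>R g2 p) + (\<tau> - (\<Sum>p\<in>P. t p * snd p)) *\<^sub>R ((0, 1), 0)"
    have wU: "w \<in> convex_cone hull U"
      unfolding w_def using t \<nu>
      by (intro convex_cone_hull_add convex_cone_hull_sum convex_cone_hull_mul hull_inc) (auto simp: U_def Nbeta_def)
    have sum\<nu>: "(\<Sum>\<alpha>\<in>A-{\<beta>}. \<nu> \<alpha>) = - \<nu> \<beta>"
      using \<nu> finite assms by (simp add: Nbeta_def sum.remove)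
    have "snd w = (\<Sum>\<alpha>\<in>A-{\<beta>}. \<nu> \<alpha> *\<^sub>R (\<alpha> - \<beta>)) + (\<Sum>p\<in>P. t p *\<^sub>R fst p)"
      by (simp add: w_def snd_sum g1_def g2_def)
    also have "(\<Sum>\<alpha>\<in>A-{\<beta>}. \<nu> \<alpha> *\<^sub>R (\<alpha> - \<beta>)) = (\<Sum>\<alpha>\<in>A-{\<beta>}. \<nu> \<alpha> *\<^sub>R \<alpha>) - (\<Sum>\<alpha>\<in>A-{\<beta>}. \<nu> \<alpha>) *\<^sub>R \<beta>"
      by (simp add: scaleR_diff_right sum_subtractf scaleR_sum_left)
    also have "\<dots> = Amul A \<nu>"
      using finite assms by (simp add: sum\<nu> Amul_def sum.remove)
    finally have snd: "snd w = 0"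
      using t(2) by (metis add.right_inverse)
    have "fst (fst w) \<gamma> = \<nu> \<gamma>" for \<gamma>
    proof -
      have "fst (fst w) \<gamma> = (\<Sum>\<alpha>\<in>A-{\<beta>}. \<nu> \<alpha> * (e \<alpha> \<gamma> - e \<beta> \<gamma>))"
        by (simp add: w_def fst_sum g1_def g2_def sum_fun_apply)
      also have "\<dots> = (\<Sum>\<alpha>\<in>A-{\<beta>}. \<nu> \<alpha> * e \<alpha> \<gamma>) - (\<Sum>\<alpha>\<in>A-{\<beta>}. \<nu> \<alpha>) * e \<beta> \<gamma>"
        by (simp add: right_diff_distrib sum_subtractf sum_distrib_right)
      also have "(\<Sum>\<alpha>\<in>A-{\<beta>}. \<nu> \<alpha> * e \<alpha> \<gamma>) = (if \<gamma> \<in> A - {\<beta>} then \<nu> \<gamma> else 0)"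
        using finite by (simp add: e_def if_distrib[of "\<lambda>r. _ * r"] sum.delta' cong: if_cong)
      finally show ?thesis
        using \<nu> sum\<nu> by (auto simp: e_def Nbeta_def in_RA_def)
    qed
    moreover have "snd (fst w) = \<tau>"
      by (simp add: w_def fst_sum snd_sum g1_def g2_def)
    ultimately have "fst w = p" by (auto simp: p prod_eq_iff fun_eq_iff)
    then show "p \<in> fst ` (convex_cone hull T)"
      using wU snd T(2) K by (metis IntI imageI)
  qed
  then have "convex_cone hull (fst ` T) = epi \<beta>"
    by (simp add: convex_cone_hull_linear_image linear_fst)
  then show thesis using that T(1) by blast
qed

text \<open>Height above the support function is a vertical summand, so an extreme ray with nonzero
  first component lies on the graph. A convex combination forbidden for circuits would, by affinity,
  lift to a sum of two points of the epigraph; extremality makes both multiples of one vector, hence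
  proportional.\<close>

lemma extreme_ray_epi:
  assumes "extreme_ray (epi \<beta>) p" "\<beta> \<in> A"
  shows "(fst p = 0 \<and> snd p > 0) \<or> (\<exists>lam k. k > 0 \<and> X_circuit X A \<beta> lam \<and> lam \<beta> = -1 \<and> p = k *\<^sub>R funform X A lam)"
proof -
  obtain \<nu> \<tau> where p: "p = (\<nu>, \<tau>)" by (cases p)
  have p0: "p \<noteq> 0" "p \<in> epi \<beta>" using assms(1) by (auto simp: extreme_ray_iff)
  show ?thesis
  proof (cases "\<nu> = 0")
    case True
    then have "\<tau> \<ge> 0" "\<tau> \<noteq> 0"
      using p0 nonempty by (auto simp: support_epigraph_def p zero_prod_def)
    then show ?thesis using True p by simp
  next
    case False
    define r where "r = - \<nu> \<beta>"
    define lam where "lam = (1 / r) *\<^sub>R \<nu>"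
    define q where "q = (lam, \<tau> / r)"
    have r: "r > 0"
      using Nbeta_neg(2)[OF finite assms(2)] p0(2) False by (auto simp: support_epigraph_def p r_def)
    have q: "q = (1 / r) *\<^sub>R p" "p = r *\<^sub>R q" using r by (auto simp: q_def lam_def p)
    have ext: "extreme_ray (epi \<beta>) q"
      unfolding q(1) using assms(1) r convex_cone_epi by (intro extreme_ray_scaleR) auto
    then have qe: "(lam, \<tau> / r) \<in> epi \<beta>" by (simp add: extreme_ray_iff q_def)
    have split: "x \<in> ray q \<and> y \<in> ray q" if "x \<in> epi \<beta>" "y \<in> epi \<beta>" "x + y = q" for x y
      using ext ray_self[of q] that unfolding extreme_ray_iff by simp
    have lam: "lam \<beta> = -1" using r by (simp add: lam_def r_def)
    note sig = epi_sig[OF qe]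
    have "(0, \<tau> / r - sig lam) \<in> epi \<beta>"
      using sig(2) by (simp add: support_epigraph_def Nbeta_zero)
    then have "(0, \<tau> / r - sig lam) \<in> ray q"
      using split[OF sig(3)] by (simp add: q_def)
    then obtain t where t: "0 = t *\<^sub>R lam" "\<tau> / r - sig lam = t * (\<tau> / r)"
      by (auto simp: ray_eq q_def)
    have "t = 0" using fun_cong[OF t(1), of \<beta>] lam by simp
    then have qf: "q = funform X A lam" using t(2) by (simp add: q_def funform_eq)
    have "X_circuit X A \<beta> lam"
      unfolding X_circuit_def
    proof (intro conjI notI)
      show "lam \<in> Nbeta A \<beta>" using qe by (simp add: support_epigraph_def)
      show False if "lam = (\<lambda>_. 0)" using that lam by simp
      show "supp_fun X (- Amul A lam) < \<infinity>" using sig(1) by simp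
      assume "\<exists>\<nu>1 \<nu>2 \<theta>. \<nu>1 \<in> Nbeta A \<beta> \<and> \<nu>2 \<in> Nbeta A \<beta> \<and> \<not> proportional \<nu>1 \<nu>2 \<and>
          \<theta> \<in> {0<..<1::real} \<and> lam = (\<lambda>\<alpha>. \<theta> * \<nu>1 \<alpha> + (1 - \<theta>) * \<nu>2 \<alpha>) \<and> affine_on_segment X A \<nu>1 \<nu>2"
      then obtain \<nu>1 \<nu>2 \<theta> where N: "\<nu>1 \<in> Nbeta A \<beta>" "\<nu>2 \<in> Nbeta A \<beta>" "\<not> proportional \<nu>1 \<nu>2"
        and \<theta>: "0 < \<theta>" "\<theta> < 1" "lam = (\<lambda>\<alpha>. \<theta> * \<nu>1 \<alpha> + (1 - \<theta>) * \<nu>2 \<alpha>)" and aff: "affine_on_segment X A \<nu>1 \<nu>2"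
        by auto
      obtain a b where ab: "\<And>t. t \<in> {0..1} \<Longrightarrow>
          supp_fun X (- Amul A (\<lambda>\<alpha>. (1 - t) * \<nu>1 \<alpha> + t * \<nu>2 \<alpha>)) = ereal (a + b * t)"
        using aff unfolding affine_on_segment_def by blast
      have s1: "supp_fun X (- Amul A \<nu>1) = ereal a" using ab[of 0] by simp
      have s2: "supp_fun X (- Amul A \<nu>2) = ereal (a + b)" using ab[of 1] by simp
      \<comment> \<open>The circuit condition weights \<open>\<nu>1\<close> by \<theta>, whereas the
        affine parametrisation weights \<open>\<nu>2\<close> by its parameter; hence
        \<open>1 - \<theta>\<close>.\<close>
      have s3: "sig lam = a + b * (1 - \<theta>)" using ab[of "1 - \<theta>"] \<theta> sig(1) by simp
      have e1: "\<theta> *\<^sub>R (\<nu>1, a) \<in> epi \<beta>"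
        using funform_in_epi[OF N(1)] s1 \<theta> by (intro convex_cone_scaleR[OF convex_cone_epi]) (auto simp: funform_def)
      have e2: "(1 - \<theta>) *\<^sub>R (\<nu>2, a + b) \<in> epi \<beta>"
        using funform_in_epi[OF N(2)] s2 \<theta> by (intro convex_cone_scaleR[OF convex_cone_epi]) (auto simp: funform_def)
      have "\<theta> *\<^sub>R (\<nu>1, a) + (1 - \<theta>) *\<^sub>R (\<nu>2, a + b) = q"
        unfolding qf funform_eq s3 using \<theta>(3) by (auto simp: fun_eq_iff algebra_simps)
      then have "\<theta> *\<^sub>R (\<nu>1, a) \<in> ray q" "(1 - \<theta>) *\<^sub>R (\<nu>2, a + b) \<in> ray q"
        using split[OF e1 e2] by auto
      then obtain t1 t2 where "\<theta> *\<^sub>R \<nu>1 = t1 *\<^sub>R lam" "(1 - \<theta>) *\<^sub>R \<nu>2 = t2 *\<^sub>R lam"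
        by (auto simp: ray_eq q_def)
      then have t12: "\<theta> * \<nu>1 \<alpha> = t1 * lam \<alpha>" "(1 - \<theta>) * \<nu>2 \<alpha> = t2 * lam \<alpha>" for \<alpha>
        by (metis scaleR_fun_apply real_scaleR_def)+
      have "proportional \<nu>1 \<nu>2"
      proof (cases "t2 = 0")
        case True
        then have "\<nu>2 = (\<lambda>\<alpha>. 0 * \<nu>1 \<alpha>)" using t12(2) \<theta> by (auto simp: fun_eq_iff)
        then show ?thesis unfolding proportional_def by blast
      next
        case False
        have "\<nu>1 \<alpha> = (t1 * (1 - \<theta>) / (\<theta> * t2)) * \<nu>2 \<alpha>" for \<alpha>
        proof -
          have "lam \<alpha> = (1 - \<theta>) * \<nu>2 \<alpha> / t2" using t12(2)[of \<alpha>] False by (simp add: field_simps)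
          moreover have "\<nu>1 \<alpha> = t1 * lam \<alpha> / \<theta>"
            using t12(1)[of \<alpha>] \<theta>(1) by (simp add: nonzero_eq_divide_eq mult.commute)
          ultimately show ?thesis by (simp add: mult.commute)
        qed
        then show ?thesis unfolding proportional_def by blast
      qed
      then show False using N(3) by simp
    qed
    then show ?thesis using r lam q(2) qf by blast
  qed
qed

text \<open>For a fixed \<beta> the epigraph is pointed for simple reasons:
  \<open>- \<nu> \<beta>\<close> is nonnegative and vanishes on \<open>Nbeta A \<beta>\<close> only
  at 0, and over 0 the height is nonnegative. So its extreme generators suffice.\<close>

lemma epi_subset_circuits:
  assumes "\<beta> \<in> A"
  obtains L where "finite L" "L \<subseteq> Lambda_X X A" "epi \<beta> \<subseteq> convex_cone hull (funform X A ` L \<union> {(0, 1)})"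
proof -
  obtain S0 where S0: "finite S0" "convex_cone hull S0 = epi \<beta>"
    using epi_finitely_generated[OF assms] by blast
  define S where "S = S0 - {0}"
  have S: "finite S" "convex_cone hull S = epi \<beta>" "0 \<notin> S"
    using S0 by (auto simp: S_def convex_cone_hull_Diff_zero)
  have Sepi: "s \<in> epi \<beta>" if "s \<in> S" for s using S(2) that by (metis hull_inc)
  have "\<forall>s\<in>S. a s = 0" if a: "\<And>s. s \<in> S \<Longrightarrow> a s \<ge> 0" and a0: "(\<Sum>s\<in>S. a s *\<^sub>R s) = 0" for a
  proof -
    have "fst (\<Sum>s\<in>S. a s *\<^sub>R s) \<beta> = 0" "snd (\<Sum>s\<in>S. a s *\<^sub>R s) = 0" using a0 by simp_all
    then have f: "(\<Sum>s\<in>S. a s * - fst s \<beta>) = 0" and g: "(\<Sum>s\<in>S. a s * snd s) = 0"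
      by (simp_all add: fst_sum snd_sum sum_fun_apply sum_negf)
    have "a s * - fst s \<beta> \<ge> 0" if "s \<in> S" for s
      using a[OF that] Nbeta_neg(1)[OF finite assms, of "fst s"] Sepi[OF that]
      by (intro mult_nonneg_nonneg) (auto simp: support_epigraph_def)
    then have "\<forall>s\<in>S. a s * - fst s \<beta> = 0"
      using f S(1) by (subst (asm) sum_nonneg_eq_0_iff) auto
    then have f0: "a s = 0 \<or> fst s = 0" if "s \<in> S" for s
      using Nbeta_neg(2)[OF finite assms, of "fst s"] Sepi[OF that] that
      by (fastforce simp: support_epigraph_def)
    have s0: "snd s \<ge> 0" if "s \<in> S" "fst s = 0" for s
      using Sepi[OF that(1)] that(2) nonempty by (auto simp: support_epigraph_def)
    have "a s * snd s \<ge> 0" if "s \<in> S" for s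
      using f0[OF that] s0[OF that] a[OF that] by auto
    then have "\<forall>s\<in>S. a s * snd s = 0"
      using g S(1) by (subst (asm) sum_nonneg_eq_0_iff) auto
    then show ?thesis
      using f0 S(3) by (metis mult_eq_0_iff prod.collapse zero_prod_def)
  qed
  then have ext: "convex_cone hull {s \<in> S. extreme_ray (epi \<beta>) s} = epi \<beta>"
    using convex_cone_hull_extreme_generators[OF S(1)] by (simp add: S(2))
  define E where "E = {s \<in> S. extreme_ray (epi \<beta>) s}"
  have "\<exists>lam. fst s \<noteq> 0 \<longrightarrow> lam \<in> Lambda_X X A \<and> s \<in> convex_cone hull {funform X A lam}" if "s \<in> E" for s
  proof (cases "fst s = 0")
    case False
    then obtain lam k where "k > 0" "X_circuit X A \<beta> lam" "lam \<beta> = -1" "s = k *\<^sub>R funform X A lam"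
      using extreme_ray_epi[of \<beta> s] \<open>s \<in> E\<close> assms by (auto simp: E_def)
    then show ?thesis
      using assms by (intro exI[of _ lam]) (auto simp: Lambda_X_def intro!: convex_cone_hull_mul intro: hull_inc)
  qed auto
  then obtain l where l: "\<And>s. s \<in> E \<Longrightarrow> fst s \<noteq> 0 \<Longrightarrow> l s \<in> Lambda_X X A \<and> s \<in> convex_cone hull {funform X A (l s)}"
    by metis
  define L where "L = l ` {s \<in> E. fst s \<noteq> 0}"
  let ?H = "convex_cone hull (funform X A ` L \<union> {(0, 1)})"
  have "s \<in> ?H" if s: "s \<in> E" for s
  proof (cases "fst s = 0")
    case True
    then have "s = snd s *\<^sub>R (0, 1)" "snd s \<ge> 0"
      using extreme_ray_epi[of \<beta> s] s assms by (auto simp: E_def prod_eq_iff funform_eq)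
    then show ?thesis
      by (metis UnI2 convex_cone_hull_mul hull_inc singletonI)
  next
    case False
    have "convex_cone hull {funform X A (l s)} \<subseteq> ?H"
      using False s by (intro hull_mono) (auto simp: L_def)
    then show ?thesis using l[OF s False] by blast
  qed
  then have "convex_cone hull E \<subseteq> ?H"
    by (intro hull_minimal convex_cone_convex_cone_hull) auto
  then have "epi \<beta> \<subseteq> ?H" using ext by (simp add: E_def)
  moreover have "L \<subseteq> Lambda_X X A" using l by (auto simp: L_def)
  moreover have "finite L" using S(1) by (simp add: L_def E_def)
  ultimately show thesis using that by blast
qed

text \<open>The functional form of any circuit lies in the epigraph of its index, and each of the
  finitely many epigraphs is covered by a cone over finitely many circuits and
  \<open>(0, 1)\<close>; the union of these finite sets serves for all circuits at once.\<close>

lemma circuit_graph_finitely_generated: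
  obtains L where "finite L" "L \<subseteq> Lambda_X X A"
    "circuit_graph X A = convex_cone hull (funform X A ` L \<union> {(0, 1)})"
    "\<And>\<beta>. \<beta> \<in> A \<Longrightarrow> epi \<beta> \<subseteq> circuit_graph X A"
proof -
  have "\<forall>\<beta>\<in>A. \<exists>L. finite L \<and> L \<subseteq> Lambda_X X A \<and> epi \<beta> \<subseteq> convex_cone hull (funform X A ` L \<union> {(0, 1)})"
    using epi_subset_circuits by metis
  then obtain l where l: "\<And>\<beta>. \<beta> \<in> A \<Longrightarrow> finite (l \<beta>)" "\<And>\<beta>. \<beta> \<in> A \<Longrightarrow> l \<beta> \<subseteq> Lambda_X X A"
      "\<And>\<beta>. \<beta> \<in> A \<Longrightarrow> epi \<beta> \<subseteq> convex_cone hull (funform X A ` l \<beta> \<union> {(0, 1)})"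
    by metis
  define L where "L = (\<Union>\<beta>\<in>A. l \<beta>)"
  let ?T = "funform X A ` L \<union> {(0, 1)}"
  have L: "finite L" "L \<subseteq> Lambda_X X A" using l finite by (auto simp: L_def)
  have epi: "epi \<beta> \<subseteq> convex_cone hull ?T" if "\<beta> \<in> A" for \<beta>
    using l(3)[OF that] hull_mono[of "funform X A ` l \<beta> \<union> {(0, 1)}" ?T convex_cone] that
    by (auto simp: L_def)
  have "circuit_graph X A = convex_cone hull ?T"
  proof
    have "funform X A ` Lambda_X X A \<subseteq> convex_cone hull ?T"
    proof
      fix p assume "p \<in> funform X A ` Lambda_X X A"
      then obtain \<beta> lam where "\<beta> \<in> A" "X_circuit X A \<beta> lam" "p = funform X A lam"
        by (auto simp: Lambda_X_def)
      then show "p \<in> convex_cone hull ?T"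
        using epi[of \<beta>] funform_in_epi circuit_entries by blast
    qed
    moreover have "((\<lambda>_. 0), 1) \<in> convex_cone hull ?T"
      by (intro hull_inc) (auto simp: zero_fun_def)
    ultimately show "circuit_graph X A \<subseteq> convex_cone hull ?T"
      unfolding circuit_graph_def by (intro cone_hull_subset) auto
    show "convex_cone hull ?T \<subseteq> circuit_graph X A"
      unfolding circuit_graph_def using L
      by (intro convex_cone_hull_subset_cone_hull) (auto simp: zero_fun_def)
  qed
  then show thesis using that L epi by simp
qed

lemma epi_subset_circuit_graph: "\<beta> \<in> A \<Longrightarrow> epi \<beta> \<subseteq> circuit_graph X A"
  using circuit_graph_finitely_generated by metis

text \<open>In a vanishing combination every circuit \<open>\<nu>\<close> involved has \<open>A \<nu>\<close> orthogonal to all directions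
  \<open>d\<close> of \<open>X\<close>. Then \<open>\<Sum> \<nu>\<^sub>\<alpha> (\<alpha> \<bullet> d)\<^sup>2 = \<Sum> \<nu>\<^sub>\<alpha> ((\<alpha> - \<beta>) \<bullet> d)\<^sup>2 \<ge> 0\<close>, and linear independence
  of the exponentials makes this positive for some \<open>d\<close>.\<close>

lemma circuits_pointed:
  assumes L: "finite L" "L \<subseteq> Lambda_X X A"
    and a: "\<And>s. s \<in> funform X A ` L \<union> {(0, 1)} \<Longrightarrow> a s \<ge> 0"
    and zero: "(\<Sum>s\<in>funform X A ` L \<union> {(0, 1)}. a s *\<^sub>R s) = 0"
  shows "\<forall>s\<in>funform X A ` L \<union> {(0, 1)}. a s = 0"
proof -
  define T where "T = funform X A ` L \<union> {(0, 1)}"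
  have finT: "finite T" using L(1) by (simp add: T_def)
  have functional: "(\<Sum>s\<in>T. a s * f s) = 0" if "linear f" for f :: "_ \<Rightarrow> real"
  proof -
    have "f (\<Sum>s\<in>T. a s *\<^sub>R s) = 0" using zero that by (simp add: T_def linear_0)
    then show ?thesis using that by (simp add: linear_sum linear_cmul)
  qed
  \<comment> \<open>A functional nonnegative on all generators in use vanishes on each of them,
    since its weighted values add up to 0.\<close>
  have vanish: "f s = 0" if "linear f" "\<And>s. s \<in> T \<Longrightarrow> a s > 0 \<Longrightarrow> f s \<ge> 0" "s \<in> T" "a s > 0" for f :: "_ \<Rightarrow> real" and s
  proof -
    have "a s * f s \<ge> 0" if "s \<in> T" for s
      using that \<open>\<And>s. s \<in> T \<Longrightarrow> a s > 0 \<Longrightarrow> f s \<ge> 0\<close>[of s] a[of s] by (cases "a s = 0") (auto simp: T_def)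
    then have "\<forall>s\<in>T. a s * f s = 0"
      using functional[OF that(1)] finT by (subst (asm) sum_nonneg_eq_0_iff) auto
    then show ?thesis using that by fastforce
  qed
  have Tepi: "s = (0, 1) \<or> (\<exists>\<beta>\<in>A. s \<in> epi \<beta> \<and> fst s \<noteq> 0)" if "s \<in> T" for s
  proof (cases "s = (0, 1)")
    case False
    then obtain lam \<beta> where "\<beta> \<in> A" "X_circuit X A \<beta> lam" "s = funform X A lam"
      using \<open>s \<in> T\<close> L(2) by (auto simp: T_def Lambda_X_def)
    then show ?thesis
      using funform_in_epi circuit_entries[of X A \<beta> lam] by (auto simp: funform_eq)
  qed simp
  have tight: "Amul A (fst s) \<bullet> x + snd s = 0" if "x \<in> X" "s \<in> T" "a s > 0" for x s
  proof (rule vanish[of "\<lambda>s. Amul A (fst s) \<bullet> x + snd s"])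
    show "linear (\<lambda>s. Amul A (fst s) \<bullet> x + snd s)"
      by (auto intro!: linearI simp: Amul_add Amul_scaleR inner_add_left algebra_simps)
    show "0 \<le> Amul A (fst s) \<bullet> x + snd s" if "s \<in> T" for s
      using Tepi[OF that] \<open>x \<in> X\<close> by (fastforce simp: support_epigraph_def)
  qed (use that in auto)
  have "False" if s: "s \<in> T" "a s > 0" for s
  proof -
    obtain x0 where "x0 \<in> X" using nonempty by auto
    then have "s \<noteq> (0, 1)" using tight[OF _ s] by auto
    then obtain \<beta> where "\<beta> \<in> A" "s \<in> epi \<beta>" "fst s \<noteq> 0"
      using Tepi[OF s(1)] by blast
    then have \<beta>: "\<beta> \<in> A" "fst s \<in> Nbeta A \<beta>" "fst s \<noteq> 0"
      by (auto simp: support_epigraph_def)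
    obtain \<alpha> where \<alpha>: "\<alpha> \<in> A" "\<alpha> \<noteq> \<beta>" "fst s \<alpha> > 0"
    proof (rule ccontr)
      assume "\<not> thesis"
      then have "\<forall>\<alpha>\<in>A-{\<beta>}. fst s \<alpha> = 0"
        using \<beta>(2) that by (force simp: Nbeta_def)
      then have "(\<Sum>\<alpha>\<in>A. fst s \<alpha>) = fst s \<beta>" using finite \<beta>(1) by (simp add: sum.remove)
      then show False using \<beta> Nbeta_neg(2)[OF finite \<beta>] by (simp add: Nbeta_def)
    qed
    obtain x x' where x: "x \<in> X" "x' \<in> X" "(\<alpha> - \<beta>) \<bullet> (x - x') \<noteq> 0"
      using exponentials_separated[OF indep finite \<alpha>(1) \<beta>(1) \<alpha>(2)] by blast
    define d where "d = x - x'"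
    have orth: "Amul A (fst s) \<bullet> d = 0" if "s \<in> T" "a s > 0" for s
      using tight[OF x(1) that] tight[OF x(2) that] by (simp add: d_def inner_diff_right)
    \<comment> \<open>Because \<open>Amul A (fst s)\<close> is orthogonal to \<open>d\<close> and
      the entries sum to 0, the squares may be centred at any \<beta>. So this single functional is
      nonnegative on circuits with different negative indices.\<close>
    define Q where "Q = (\<lambda>p :: ('a \<Rightarrow> real) \<times> real. \<Sum>\<gamma>\<in>A. fst p \<gamma> * (\<gamma> \<bullet> d)\<^sup>2)"
    have linQ: "linear Q"
      by (auto intro!: linearI simp: Q_def algebra_simps sum.distrib sum_distrib_left)
    have Qeq: "Q s = (\<Sum>\<gamma>\<in>A. fst s \<gamma> * ((\<gamma> - \<beta>) \<bullet> d)\<^sup>2)" if "s \<in> T" "a s > 0" "fst s \<in> Nbeta A \<beta>" for s \<beta>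
    proof -
      have "(\<Sum>\<gamma>\<in>A. fst s \<gamma> * ((\<gamma> - \<beta>) \<bullet> d)\<^sup>2)
          = (\<Sum>\<gamma>\<in>A. fst s \<gamma> * (\<gamma> \<bullet> d)\<^sup>2 - 2 * (\<beta> \<bullet> d) * (fst s \<gamma> * (\<gamma> \<bullet> d)) + (\<beta> \<bullet> d)\<^sup>2 * fst s \<gamma>)"
        by (intro sum.cong) (auto simp: inner_diff_left power2_eq_square algebra_simps)
      also have "\<dots> = Q s - 2 * (\<beta> \<bullet> d) * (Amul A (fst s) \<bullet> d) + (\<beta> \<bullet> d)\<^sup>2 * (\<Sum>\<gamma>\<in>A. fst s \<gamma>)"
        by (simp add: Q_def Amul_inner sum.distrib sum_subtractf sum_distrib_left)
      finally show ?thesis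
        using orth[OF that(1,2)] that(3) by (simp add: Nbeta_def)
    qed
    have terms: "fst s \<gamma> * ((\<gamma> - \<beta>) \<bullet> d)\<^sup>2 \<ge> 0" if "fst s \<in> Nbeta A \<beta>" "\<gamma> \<in> A" for s :: "('a \<Rightarrow> real) \<times> real" and \<beta> \<gamma>
      using that by (cases "\<gamma> = \<beta>") (auto simp: Nbeta_def)
    have "Q s = 0"
    proof (rule vanish[OF linQ _ s])
      fix s assume s: "s \<in> T" "a s > 0"
      show "Q s \<ge> 0"
        using Tepi[OF s(1)]
      proof
        assume "s = (0, 1)" then show ?thesis by (simp add: Q_def)
      next
        assume "\<exists>\<beta>\<in>A. s \<in> epi \<beta> \<and> fst s \<noteq> 0"
        then obtain \<beta> where "fst s \<in> Nbeta A \<beta>" by (auto simp: support_epigraph_def)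
        then show ?thesis unfolding Qeq[OF s \<open>fst s \<in> Nbeta A \<beta>\<close>] by (intro sum_nonneg terms)
      qed
    qed
    then have "\<forall>\<gamma>\<in>A. fst s \<gamma> * ((\<gamma> - \<beta>) \<bullet> d)\<^sup>2 = 0"
      unfolding Qeq[OF s \<beta>(2)] using terms[OF \<beta>(2)] finite by (subst (asm) sum_nonneg_eq_0_iff) auto
    then show False using \<alpha> x(3) by (auto simp: d_def)
  qed
  then show ?thesis
    using a unfolding T_def[symmetric] by (metis less_le)
qed

text \<open>A nonnegative multiple cannot create a negative entry elsewhere, and normalising that
  entry to -1 fixes the factor.\<close>

lemma Lambda_X_scaleR_unique:
  assumes "lam \<in> Lambda_X X A" "mu \<in> Lambda_X X A" "mu = k *\<^sub>R lam" "k \<ge> 0"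
  shows "mu = lam"
proof -
  obtain \<beta> where \<beta>: "\<beta> \<in> A" "lam \<in> Nbeta A \<beta>" "lam \<beta> = -1"
    using assms(1) by (auto simp: Lambda_X_def X_circuit_def)
  obtain \<gamma> where \<gamma>: "\<gamma> \<in> A" "mu \<in> Nbeta A \<gamma>" "mu \<gamma> = -1"
    using assms(2) by (auto simp: Lambda_X_def X_circuit_def)
  have eq: "k * lam \<gamma> = -1" using \<gamma>(3) assms(3) by simp
  then have "\<gamma> = \<beta>"
    using \<beta>(2) \<gamma>(1) assms(4) mult_nonneg_nonneg[of k "lam \<gamma>"] by (force simp: Nbeta_def)
  then show ?thesis using eq \<beta>(3) assms(3) by simp
qed

text \<open>Every extreme ray contains a generator, so any finite generating set of circuits
  contains all reduced ones; conversely pointedness makes the extreme generators suffice. The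
  generator \<open>(0, 1)\<close> is kept without deciding whether it is extreme.\<close>

lemma finite_Lambda_X_star: "finite (Lambda_X_star X A)"
  and circuit_graph_reduced: "circuit_graph X A = convex_cone hull (funform X A ` Lambda_X_star X A \<union> {(0, 1)})"
proof -
  obtain L where L: "finite L" "L \<subseteq> Lambda_X X A"
    and G: "circuit_graph X A = convex_cone hull (funform X A ` L \<union> {(0, 1)})"
    using circuit_graph_finitely_generated by metis
  let ?T = "funform X A ` L \<union> {(0, 1)}"
  have finT: "finite ?T" using L(1) by simp
  have nz: "lam \<noteq> 0" if "lam \<in> Lambda_X X A" for lam
    using that by (auto simp: Lambda_X_def)
  have "Lambda_X_star X A \<subseteq> L"
  proof
    fix lam assume "lam \<in> Lambda_X_star X A"
    then have lam: "lam \<in> Lambda_X X A" "extreme_ray (convex_cone hull ?T) (funform X A lam)"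
      by (auto simp: Lambda_X_star_def G)
    obtain s k where s: "s \<in> ?T" "k > 0" "s = k *\<^sub>R funform X A lam"
      using extreme_ray_multiple_of_generator[OF lam(2) finT] by metis
    have "s \<noteq> (0, 1)" using s nz[OF lam(1)] by (auto simp: funform_eq)
    then obtain mu where mu: "mu \<in> L" "s = funform X A mu" using s(1) by auto
    then have "mu = k *\<^sub>R lam" using s(3) by (simp add: funform_eq)
    then have "mu = lam"
      using Lambda_X_scaleR_unique[OF lam(1)] mu(1) L(2) s(2) by (metis less_imp_le subsetD)
    then show "lam \<in> L" using mu by simp
  qed
  then show "finite (Lambda_X_star X A)" using L(1) finite_subset by blast
  have "convex_cone hull {s \<in> ?T. extreme_ray (circuit_graph X A) s} = circuit_graph X A"
    unfolding G by (rule convex_cone_hull_extreme_generators[OF finT circuits_pointed[OF L]])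
  moreover have "{s \<in> ?T. extreme_ray (circuit_graph X A) s} \<subseteq> funform X A ` Lambda_X_star X A \<union> {(0, 1)}"
    using L(2) by (auto simp: Lambda_X_star_def)
  ultimately have "circuit_graph X A \<subseteq> convex_cone hull (funform X A ` Lambda_X_star X A \<union> {(0, 1)})"
    using hull_mono[of "{s \<in> ?T. extreme_ray (circuit_graph X A) s}" _ convex_cone] by simp
  moreover have "convex_cone hull (funform X A ` Lambda_X_star X A \<union> {(0, 1)}) \<subseteq> circuit_graph X A"
    unfolding G
    by (rule hull_minimal) (use G in \<open>auto simp: Lambda_X_star_def extreme_ray_iff convex_cone_convex_cone_hull intro: hull_inc\<close>)
  ultimately show "circuit_graph X A = convex_cone hull (funform X A ` Lambda_X_star X A \<union> {(0, 1)})"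
    by (rule subset_antisym)
qed

end

section \<open>Compactness in product spaces and separation from finitely generated cones\<close>

lemma compact_box:
  fixes K :: "'i \<Rightarrow> 'b::topological_space set"
  assumes "\<And>i. compact (K i)"
  shows "compact {f. \<forall>i. f i \<in> K i}"
proof -
  \<comment> \<open>Tychonoff's theorem; applied twice, it also covers families of vectors.\<close>
  have "compactin (product_topology (\<lambda>_. euclidean) UNIV) (PiE UNIV K)"
    using assms by (simp add: compactin_PiE)
  moreover have "PiE UNIV K = {f. \<forall>i. f i \<in> K i}" by auto
  ultimately show ?thesis by (simp add: euclidean_product_topology)
qed

text \<open>The limit as \<open>t\<close> tends to 0, which produces the first-order condition at a
  closest point.\<close>

lemma nonpos_if_le_multiples:
  fixes a b :: real
  assumes "\<And>t. 0 < t \<Longrightarrow> t \<le> 1 \<Longrightarrow> a \<le> t * b"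
  shows "a \<le> 0"
proof (rule ccontr)
  assume "\<not> a \<le> 0"
  \<comment> \<open>Small enough that \<open>t * b\<close> is at most \<open>a / 2\<close>.\<close>
  define t where "t = min 1 (a / (2 * (\<bar>b\<bar> + 1)))"
  have t: "0 < t" "t \<le> 1" using \<open>\<not> a \<le> 0\<close> by (auto simp: t_def)
  have "t * b \<le> t * (\<bar>b\<bar> + 1)" using t by (intro mult_left_mono) auto
  also have "\<dots> \<le> a / (2 * (\<bar>b\<bar> + 1)) * (\<bar>b\<bar> + 1)" by (intro mult_right_mono) (auto simp: t_def)
  also have "\<dots> = a / 2" by (simp add: field_simps)
  finally show False using assms[OF t] \<open>\<not> a \<le> 0\<close> by simp
qed

text \<open>If no functional separates, Farkas' lemma writes the pairing with \<open>p\<close> as a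
  nonnegative combination of the pairings with \<open>T\<close>. Testing on unit vectors recovers
  the coordinates in \<open>A\<close>; the others vanish by \<open>in_RA\<close>.\<close>

lemma farkas_separation:
  fixes T :: "(('a \<Rightarrow> real) \<times> real) set"
  assumes "finite A" "finite T" "\<And>s. s \<in> T \<Longrightarrow> in_RA A (fst s)" "in_RA A (fst p)" "p \<notin> convex_cone hull T"
  shows "\<exists>y r. (\<forall>s\<in>T. (\<Sum>\<alpha>\<in>A. fst s \<alpha> * y \<alpha>) + snd s * r \<ge> 0) \<and> (\<Sum>\<alpha>\<in>A. fst p \<alpha> * y \<alpha>) + snd p * r < 0"
proof (rule ccontr)
  assume no_sep: "\<not> ?thesis"
  let ?f = "\<lambda>s q :: ('a \<Rightarrow> real) \<times> real. (\<Sum>\<alpha>\<in>A. fst s \<alpha> * fst q \<alpha>) + snd s * snd q"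
  have lin: "linear (?f s)" for s
    by (intro linearI) (auto simp: algebra_simps sum.distrib sum_distrib_left)
  have "?f p q \<ge> 0" if "\<And>s. s \<in> T \<Longrightarrow> ?f s q \<ge> 0" for q
    using that no_sep by (metis not_less)
  then obtain t where t: "\<And>s. s \<in> T \<Longrightarrow> t s \<ge> 0" "\<And>q. ?f p q = (\<Sum>s\<in>T. t s * ?f s q)"
    using farkas[of T ?f "?f p"] lin assms(2) by blast
  have "fst p \<gamma> = (\<Sum>s\<in>T. t s * fst s \<gamma>)" for \<gamma>
  proof (cases "\<gamma> \<in> A")
    case True
    then show ?thesis
      using t(2)[of "(\<lambda>\<alpha>. if \<alpha> = \<gamma> then 1 else 0, 0)"] assms(1)
      by (simp add: if_distrib[of "\<lambda>r. _ * r"] cong: if_cong)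
  next
    case False
    then show ?thesis using assms(3,4) by (simp add: in_RA_def)
  qed
  moreover have "snd p = (\<Sum>s\<in>T. t s * snd s)"
    using t(2)[of "(0, 1)"] by simp
  ultimately have "p = (\<Sum>s\<in>T. t s *\<^sub>R s)"
    by (auto simp: prod_eq_iff fst_sum snd_sum sum_fun_apply fun_eq_iff)
  then show False
    using assms(5) t(1) by (auto intro!: convex_cone_hull_sum intro: hull_inc)
qed

context polyhedral_signomials
begin

abbreviation dot :: "('a \<Rightarrow> real) \<Rightarrow> ('a \<Rightarrow> real) \<Rightarrow> real" where
  "dot u v \<equiv> (\<Sum>\<alpha>\<in>A. u \<alpha> * v \<alpha>)"

section \<open>The lambda-witnessed AGE cones\<close>

lemma circuit_props:
  assumes "lam \<in> Lambda_X X A"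
  defines "\<beta> \<equiv> neg_idx A lam"
  shows "\<beta> \<in> A" "lam \<in> Nbeta A \<beta>" "lam \<beta> = -1" "(lam, sig lam) \<in> epi \<beta>" "in_RA A lam"
    "\<And>\<alpha>. \<alpha> \<in> A \<Longrightarrow> \<alpha> \<noteq> \<beta> \<Longrightarrow> lam \<alpha> \<ge> 0"
    "\<And>f. dot lam f = (\<Sum>\<alpha>\<in>{\<alpha>\<in>A. lam \<alpha> > 0}. lam \<alpha> * f \<alpha>) - f \<beta>"
    "(\<Sum>\<alpha>\<in>{\<alpha>\<in>A. lam \<alpha> > 0}. lam \<alpha>) = 1"
proof -
  obtain \<gamma> where \<gamma>: "\<gamma> \<in> A" "X_circuit X A \<gamma> lam" "lam \<gamma> = -1"
    using assms by (auto simp: Lambda_X_def)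
  then have N: "lam \<in> Nbeta A \<gamma>" by (simp add: X_circuit_def)
  then have "neg_idx A lam = \<gamma>"
    unfolding neg_idx_def using \<gamma> by (intro the_equality) (force simp: Nbeta_def)+
  then have \<beta>: "\<beta> = \<gamma>" by (simp add: \<beta>_def)
  show "\<beta> \<in> A" "lam \<in> Nbeta A \<beta>" "lam \<beta> = -1" "in_RA A lam"
    using \<gamma> N by (auto simp: \<beta> Nbeta_def)
  show nn: "\<And>\<alpha>. \<alpha> \<in> A \<Longrightarrow> \<alpha> \<noteq> \<beta> \<Longrightarrow> lam \<alpha> \<ge> 0"
    using N by (auto simp: \<beta> Nbeta_def)
  show "(lam, sig lam) \<in> epi \<beta>"
    using funform_in_epi[OF N circuit_entries(3)[OF \<gamma>(2)]] by (simp add: funform_eq \<beta>)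
  show dot: "dot lam f = (\<Sum>\<alpha>\<in>{\<alpha>\<in>A. lam \<alpha> > 0}. lam \<alpha> * f \<alpha>) - f \<beta>" for f
  proof -
    have "dot lam f = lam \<beta> * f \<beta> + (\<Sum>\<alpha>\<in>A-{\<beta>}. lam \<alpha> * f \<alpha>)"
      using finite \<gamma>(1) by (simp add: \<beta> sum.remove)
    also have "(\<Sum>\<alpha>\<in>A-{\<beta>}. lam \<alpha> * f \<alpha>) = (\<Sum>\<alpha>\<in>{\<alpha>\<in>A. lam \<alpha> > 0}. lam \<alpha> * f \<alpha>)"
      using finite nn \<gamma>(3) by (intro sum.mono_neutral_right) (force simp: \<beta>)+
    finally show ?thesis using \<gamma>(3) by (simp add: \<beta>)
  qed
  show "(\<Sum>\<alpha>\<in>{\<alpha>\<in>A. lam \<alpha> > 0}. lam \<alpha>) = 1"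
    using dot[of "\<lambda>_. 1"] N by (simp add: Nbeta_def)
qed

lemma prod_powr_eq_exp:
  assumes "\<And>\<alpha>. \<alpha> \<in> P \<Longrightarrow> z \<alpha> > 0" "finite P"
  shows "(\<Prod>\<alpha>\<in>P. (z \<alpha> :: real) powr l \<alpha>) = exp (\<Sum>\<alpha>\<in>P. l \<alpha> * ln (z \<alpha>))"
proof -
  have "z \<alpha> powr l \<alpha> = exp (l \<alpha> * ln (z \<alpha>))" if "\<alpha> \<in> P" for \<alpha>
    using assms(1)[OF that] by (simp add: powr_def)
  then show ?thesis by (simp add: exp_sum[OF assms(2)])
qed

text \<open>Weighted AM-GM, that is, Jensen's inequality for \<open>exp\<close> with weights
  \<open>lam \<alpha>\<close>. The explicit factor measures how far \<open>y\<close> is from the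
  hyperplane \<open>dot lam y + sig lam = 0\<close>; duality needs it to be at most 1, coercivity
  needs it bounded away from 1.\<close>

lemma AGE_lambda_bound:
  assumes lam: "lam \<in> Lambda_X X A" and c: "c \<in> AGE_lambda X A lam"
  shows "- c (neg_idx A lam) * exp (y (neg_idx A lam))
    \<le> exp (- (dot lam y + sig lam)) * (\<Sum>\<alpha>\<in>{\<alpha>\<in>A. lam \<alpha> > 0}. c \<alpha> * exp (y \<alpha>))"
proof -
  define \<beta> where "\<beta> = neg_idx A lam"
  note props = circuit_props[OF lam, folded \<beta>_def]
  define P where "P = {\<alpha>\<in>A. lam \<alpha> > 0}"
  have P: "finite P" "P \<subseteq> A" "\<beta> \<notin> P" using finite props(3) by (auto simp: P_def)
  have Pne: "P \<noteq> {}" using props(8) unfolding P_def by force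
  have cn: "c \<alpha> \<ge> 0" if "\<alpha> \<in> P" for \<alpha>
    using c P that by (auto simp: AGE_lambda_def \<beta>_def)
  have prod: "- c \<beta> * exp (sig lam) \<le> (\<Prod>\<alpha>\<in>P. (c \<alpha> / lam \<alpha>) powr lam \<alpha>)"
    using c by (simp add: AGE_lambda_def P_def \<beta>_def sig_def)
  have Snn: "(\<Sum>\<alpha>\<in>P. c \<alpha> * exp (y \<alpha>)) \<ge> 0" using cn by (intro sum_nonneg) auto
  have "- c \<beta> * exp (y \<beta>) \<le> exp (- (dot lam y + sig lam)) * (\<Sum>\<alpha>\<in>P. c \<alpha> * exp (y \<alpha>))"
  proof (cases "\<exists>\<alpha>\<in>P. c \<alpha> = 0")
    case True
    then obtain \<alpha> where "\<alpha> \<in> P" "(c \<alpha> / lam \<alpha>) powr lam \<alpha> = 0" by auto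
    \<comment> \<open>Since \<open>0 powr lam \<alpha>\<close> is 0, a single zero coefficient
      annihilates the product and forces \<open>c \<beta>\<close> to be nonnegative.\<close>
    then have "(\<Prod>\<alpha>\<in>P. (c \<alpha> / lam \<alpha>) powr lam \<alpha>) = 0" using P(1) by (intro prod_zero) blast+
    then have "- c \<beta> * exp (sig lam) \<le> 0" using prod by simp
    then have "c \<beta> \<ge> 0" by (simp add: zero_le_mult_iff)
    then have "- c \<beta> * exp (y \<beta>) \<le> 0" by simp
    also have "0 \<le> exp (- (dot lam y + sig lam)) * (\<Sum>\<alpha>\<in>P. c \<alpha> * exp (y \<alpha>))"
      using Snn by simp
    finally show ?thesis .
  next
    case False
    then have cpos: "c \<alpha> > 0" "lam \<alpha> > 0" if "\<alpha> \<in> P" for \<alpha>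
      using cn[OF that] that by (auto simp: less_le P_def)
    define z where "z = (\<lambda>\<alpha>. ln (c \<alpha> / lam \<alpha>) + y \<alpha>)"
    have expz: "exp (z \<alpha>) = c \<alpha> / lam \<alpha> * exp (y \<alpha>)" if "\<alpha> \<in> P" for \<alpha>
      using cpos[OF that] by (simp add: z_def exp_add)
    have "(\<Prod>\<alpha>\<in>P. (c \<alpha> / lam \<alpha>) powr lam \<alpha>) = exp (\<Sum>\<alpha>\<in>P. lam \<alpha> * ln (c \<alpha> / lam \<alpha>))"
      using P(1) cpos by (intro prod_powr_eq_exp) auto
    then have "- c \<beta> * exp (sig lam) * exp (y \<beta> - sig lam)
        \<le> exp (\<Sum>\<alpha>\<in>P. lam \<alpha> * ln (c \<alpha> / lam \<alpha>)) * exp (y \<beta> - sig lam)"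
      using prod by (intro mult_right_mono) auto
    also have "- c \<beta> * exp (sig lam) * exp (y \<beta> - sig lam) = - c \<beta> * exp (y \<beta>)"
      by (simp add: exp_diff)
    also have "exp (\<Sum>\<alpha>\<in>P. lam \<alpha> * ln (c \<alpha> / lam \<alpha>)) * exp (y \<beta> - sig lam)
        = exp (- (dot lam y + sig lam)) * exp (\<Sum>\<alpha>\<in>P. lam \<alpha> *\<^sub>R z \<alpha>)"
      unfolding exp_add[symmetric] props(7) P_def[symmetric]
      by (simp add: z_def ring_distribs sum.distrib)
    also have "exp (\<Sum>\<alpha>\<in>P. lam \<alpha> *\<^sub>R z \<alpha>) \<le> (\<Sum>\<alpha>\<in>P. lam \<alpha> * exp (z \<alpha>))"
      using convex_on_sum[OF P(1) Pne exp_convex, of lam z] props(8) cpos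
      by (simp add: P_def[symmetric] less_imp_le)
    also have "(\<Sum>\<alpha>\<in>P. lam \<alpha> * exp (z \<alpha>)) = (\<Sum>\<alpha>\<in>P. c \<alpha> * exp (y \<alpha>))"
      using expz cpos by (intro sum.cong) fastforce+
    finally show ?thesis by (simp add: mult_left_mono)
  qed
  then show ?thesis by (simp add: P_def \<beta>_def)
qed

text \<open>The product condition becomes a family of inequalities linear in \<open>c\<close>, from
  which additivity, scaling and closedness follow at once. One direction is the AM-GM bound, the
  other tests the \<open>y\<close> at which AM-GM is an equality.\<close>

lemma AGE_lambda_iff:
  assumes lam: "lam \<in> Lambda_X X A"
  shows "c \<in> AGE_lambda X A lam \<longleftrightarrow> in_RA A c \<and> (\<forall>\<alpha>\<in>A. \<alpha> \<noteq> neg_idx A lam \<longrightarrow> c \<alpha> \<ge> 0) \<and>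
    (\<forall>y. dot lam y + sig lam = 0 \<longrightarrow>
      c (neg_idx A lam) * exp (y (neg_idx A lam)) + (\<Sum>\<alpha>\<in>{\<alpha>\<in>A. lam \<alpha> > 0}. c \<alpha> * exp (y \<alpha>)) \<ge> 0)"
    (is "?L \<longleftrightarrow> ?R1 \<and> ?R2 \<and> ?R3")
proof
  assume c: ?L
  have ?R3
  proof (intro allI impI)
    fix y assume "dot lam y + sig lam = 0"
    then show "c (neg_idx A lam) * exp (y (neg_idx A lam)) + (\<Sum>\<alpha>\<in>{\<alpha>\<in>A. lam \<alpha> > 0}. c \<alpha> * exp (y \<alpha>)) \<ge> 0"
      using AGE_lambda_bound[OF lam c, of y] by simp
  qed
  then show "?R1 \<and> ?R2 \<and> ?R3" using c by (simp add: AGE_lambda_def)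
next
  assume R: "?R1 \<and> ?R2 \<and> ?R3"
  define \<beta> where "\<beta> = neg_idx A lam"
  note props = circuit_props[OF lam, folded \<beta>_def]
  define P where "P = {\<alpha>\<in>A. lam \<alpha> > 0}"
  have P: "finite P" "P \<subseteq> A" "\<beta> \<notin> P" using finite props(3) by (auto simp: P_def)
  have cn: "c \<alpha> \<ge> 0" if "\<alpha> \<in> P" for \<alpha>
    using R P that by (auto simp: \<beta>_def)
  have dual: "c \<beta> * exp ((\<Sum>\<alpha>\<in>P. lam \<alpha> * y \<alpha>) + sig lam) + (\<Sum>\<alpha>\<in>P. c \<alpha> * exp (y \<alpha>)) \<ge> 0" for y
  proof -
    \<comment> \<open>On the hyperplane the coordinate at \<beta> is determined by those on
      \<open>P\<close>, because \<open>lam \<beta> = -1\<close>; the latter are therefore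
      free.\<close>
    define y' where "y' = y(\<beta> := (\<Sum>\<alpha>\<in>P. lam \<alpha> * y \<alpha>) + sig lam)"
    have y': "y' \<alpha> = y \<alpha>" if "\<alpha> \<in> P" for \<alpha> using that P(3) by (auto simp: y'_def)
    have "dot lam y' + sig lam = 0"
      unfolding props(7) P_def[symmetric] using y' by (simp add: y'_def[THEN fun_cong, of \<beta>])
    then have "c \<beta> * exp (y' \<beta>) + (\<Sum>\<alpha>\<in>P. c \<alpha> * exp (y' \<alpha>)) \<ge> 0"
      using R by (simp add: \<beta>_def P_def)
    then show ?thesis using y' by (simp add: y'_def[THEN fun_cong, of \<beta>])
  qed
  have "- c \<beta> * exp (sig lam) \<le> (\<Prod>\<alpha>\<in>P. (c \<alpha> / lam \<alpha>) powr lam \<alpha>)"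
  proof (cases "\<exists>\<alpha>\<in>P. c \<alpha> = 0")
    case True
    then obtain \<delta> where \<delta>: "\<delta> \<in> P" "c \<delta> = 0" by auto
    have "c \<beta> \<ge> 0"
    proof (rule ccontr)
      assume neg: "\<not> c \<beta> \<ge> 0"
      define M where "M = (\<Sum>\<alpha>\<in>P. c \<alpha>)"
      have M: "M \<ge> 0" using cn by (auto simp: M_def intro: sum_nonneg)
      have l: "lam \<delta> > 0" using \<delta> by (simp add: P_def)
      \<comment> \<open>As \<open>c \<delta> = 0\<close>, raising \<open>y \<delta>\<close> costs
        nothing in the sum over \<open>P\<close>; \<open>k\<close> makes the \<beta> term equal to
        \<open>- (M + 1)\<close>, which outweighs the remaining sum \<open>M\<close>.\<close>
      define k where "k = (ln ((M + 1) / - c \<beta>) - sig lam) / lam \<delta>"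
      define y where "y = (\<lambda>\<alpha>. if \<alpha> = \<delta> then k else 0)"
      have "(\<Sum>\<alpha>\<in>P. lam \<alpha> * y \<alpha>) = lam \<delta> * k"
        using P(1) \<delta>(1) by (simp add: y_def if_distrib[of "\<lambda>r. _ * r"] cong: if_cong)
      then have "(\<Sum>\<alpha>\<in>P. lam \<alpha> * y \<alpha>) + sig lam = ln ((M + 1) / - c \<beta>)"
        using l by (simp add: k_def)
      moreover have "(M + 1) / - c \<beta> > 0" using neg M by (intro divide_pos_pos) auto
      ultimately have "c \<beta> * exp ((\<Sum>\<alpha>\<in>P. lam \<alpha> * y \<alpha>) + sig lam) = c \<beta> * ((M + 1) / - c \<beta>)"
        by simp
      also have "\<dots> = - (M + 1)" using neg by simp
      finally have "c \<beta> * exp ((\<Sum>\<alpha>\<in>P. lam \<alpha> * y \<alpha>) + sig lam) = - (M + 1)" .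
      moreover have "(\<Sum>\<alpha>\<in>P. c \<alpha> * exp (y \<alpha>)) = M"
        unfolding M_def using \<delta>(2) by (intro sum.cong) (auto simp: y_def)
      ultimately show False using dual[of y] by simp
    qed
    then have "- c \<beta> * exp (sig lam) \<le> 0" by simp
    also have "0 \<le> (\<Prod>\<alpha>\<in>P. (c \<alpha> / lam \<alpha>) powr lam \<alpha>)" by (intro prod_nonneg) auto
    finally show ?thesis .
  next
    case False
    then have cpos: "c \<alpha> > 0" "lam \<alpha> > 0" if "\<alpha> \<in> P" for \<alpha>
      using cn[OF that] that by (auto simp: less_le P_def)
    define w where "w = (\<Sum>\<alpha>\<in>P. lam \<alpha> * ln (c \<alpha> / lam \<alpha>))"
    \<comment> \<open>The equality case of AM-GM: every term becomes \<open>lam \<alpha>\<close>,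
      and the inequality linear in \<open>c\<close> turns into the product condition.\<close>
    have "(\<Sum>\<alpha>\<in>P. c \<alpha> * exp (- ln (c \<alpha> / lam \<alpha>))) = (\<Sum>\<alpha>\<in>P. lam \<alpha>)"
      using cpos by (intro sum.cong) (fastforce simp: exp_minus)+
    then have "c \<beta> * exp (- w + sig lam) + 1 \<ge> 0"
      using dual[of "\<lambda>\<alpha>. - ln (c \<alpha> / lam \<alpha>)"] props(8) by (simp add: sum_negf w_def P_def)
    then have "(- c \<beta> * exp (sig lam - w)) * exp w \<le> 1 * exp w"
      by (intro mult_right_mono) auto
    then have "- c \<beta> * exp (sig lam) \<le> exp w"
      by (simp add: exp_diff)
    also have "exp w = (\<Prod>\<alpha>\<in>P. (c \<alpha> / lam \<alpha>) powr lam \<alpha>)"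
      unfolding w_def using P(1) cpos by (intro prod_powr_eq_exp[symmetric]) auto
    finally show ?thesis .
  qed
  then show ?L using R by (simp add: AGE_lambda_def P_def \<beta>_def sig_def)
qed

lemma AGE_lambda_nonneg:
  assumes "lam \<in> Lambda_X X A" "in_RA A c" "\<And>\<alpha>. \<alpha> \<in> A \<Longrightarrow> c \<alpha> \<ge> 0"
  shows "c \<in> AGE_lambda X A lam"
  using assms circuit_props(1)[OF assms(1)]
  by (auto simp: AGE_lambda_iff intro!: add_nonneg_nonneg sum_nonneg)

lemma AGE_lambda_add:
  assumes lam: "lam \<in> Lambda_X X A" and "c \<in> AGE_lambda X A lam" "d \<in> AGE_lambda X A lam"
  shows "c + d \<in> AGE_lambda X A lam"
proof -
  have "(c + d) \<beta> * exp (y \<beta>) + (\<Sum>\<alpha>\<in>P. (c + d) \<alpha> * exp (y \<alpha>))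
      = (c \<beta> * exp (y \<beta>) + (\<Sum>\<alpha>\<in>P. c \<alpha> * exp (y \<alpha>))) + (d \<beta> * exp (y \<beta>) + (\<Sum>\<alpha>\<in>P. d \<alpha> * exp (y \<alpha>)))"
    for \<beta> y P
    by (simp add: algebra_simps sum.distrib)
  then show ?thesis
    using assms unfolding AGE_lambda_iff[OF lam] by (auto simp: in_RA_def)
qed

lemma AGE_lambda_scaleR:
  assumes lam: "lam \<in> Lambda_X X A" and "c \<in> AGE_lambda X A lam" "k \<ge> 0"
  shows "k *\<^sub>R c \<in> AGE_lambda X A lam"
proof -
  have "(k *\<^sub>R c) \<beta> * exp (y \<beta>) + (\<Sum>\<alpha>\<in>P. (k *\<^sub>R c) \<alpha> * exp (y \<alpha>))
      = k * (c \<beta> * exp (y \<beta>) + (\<Sum>\<alpha>\<in>P. c \<alpha> * exp (y \<alpha>)))" for \<beta> y P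
    by (simp add: algebra_simps sum_distrib_left)
  then show ?thesis
    using assms unfolding AGE_lambda_iff[OF lam] by (auto simp: in_RA_def)
qed

lemma closed_AGE_lambda:
  assumes "lam \<in> Lambda_X X A"
  shows "closed (AGE_lambda X A lam)"
proof -
  have cont: "continuous_on UNIV (\<lambda>c :: 'a \<Rightarrow> real. c \<alpha>)" for \<alpha> by simp
  have "AGE_lambda X A lam = {c. \<forall>\<alpha>. \<alpha> \<notin> A \<longrightarrow> c \<alpha> = 0} \<inter> {c. \<forall>\<alpha>. \<alpha> \<in> A \<longrightarrow> \<alpha> \<noteq> neg_idx A lam \<longrightarrow> c \<alpha> \<ge> 0} \<inter>
    {c. \<forall>y. dot lam y + sig lam = 0 \<longrightarrow>
      c (neg_idx A lam) * exp (y (neg_idx A lam)) + (\<Sum>\<alpha>\<in>{\<alpha>\<in>A. lam \<alpha> > 0}. c \<alpha> * exp (y \<alpha>)) \<ge> 0}"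
    using AGE_lambda_iff[OF assms] by (auto simp: in_RA_def)
  also have "closed \<dots>"
    by (intro closed_Int closed_Collect_all closed_Collect_imp closed_Collect_eq closed_Collect_le
        continuous_intros cont open_Collect_const)
  finally show ?thesis .
qed

text \<open>With margin \<open>m\<close> the negative term consumes at most the fraction
  \<open>exp (- m)\<close> of the remaining sum, so what is left controls every entry in absolute
  value.\<close>

lemma AGE_lambda_coercive:
  assumes lam: "lam \<in> Lambda_X X A" and c: "c \<in> AGE_lambda X A lam" and \<alpha>: "\<alpha> \<in> A"
    and m: "m > 0" "m \<le> dot lam y + sig lam"
  shows "(1 - exp (- m)) * (\<bar>c \<alpha>\<bar> * exp (y \<alpha>)) \<le> (\<Sum>\<alpha>\<in>A. c \<alpha> * exp (y \<alpha>))"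
proof -
  define \<beta> where "\<beta> = neg_idx A lam"
  note props = circuit_props[OF lam, folded \<beta>_def]
  define R where "R = (\<Sum>\<alpha>\<in>A-{\<beta>}. c \<alpha> * exp (y \<alpha>))"
  have cn: "c \<alpha> \<ge> 0" if "\<alpha> \<in> A - {\<beta>}" for \<alpha>
    using c that by (auto simp: AGE_lambda_def \<beta>_def)
  have cP: "c \<alpha> \<ge> 0" if "\<alpha> \<in> A" "lam \<alpha> > 0" for \<alpha>
    using cn[of \<alpha>] props(3) that by (cases "\<alpha> = \<beta>") auto
  have R0: "R \<ge> 0" using cn unfolding R_def by (intro sum_nonneg) auto
  have "(\<Sum>\<alpha>\<in>{\<alpha>\<in>A. lam \<alpha> > 0}. c \<alpha> * exp (y \<alpha>)) \<le> R"
    unfolding R_def using finite props(3) cn by (intro sum_mono2) auto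
  then have "exp (- (dot lam y + sig lam)) * (\<Sum>\<alpha>\<in>{\<alpha>\<in>A. lam \<alpha> > 0}. c \<alpha> * exp (y \<alpha>)) \<le> exp (- m) * R"
    using m cP by (intro mult_mono) (auto intro!: sum_nonneg)
  then have neg: "- c \<beta> * exp (y \<beta>) \<le> exp (- m) * R"
    using AGE_lambda_bound[OF lam c, of y] by (simp add: \<beta>_def)
  have tot: "(\<Sum>\<alpha>\<in>A. c \<alpha> * exp (y \<alpha>)) = c \<beta> * exp (y \<beta>) + R"
    using finite props(1) by (simp add: R_def sum.remove)
  have em: "exp (- m) * R \<le> R" "0 \<le> exp (- m) * R" using m R0 by (auto intro: mult_left_le_one_le)
  \<comment> \<open>Either the entry is dominated by \<open>R\<close>, or it is a nonnegative entry
    at \<beta> and hence counts fully in the total.\<close>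
  have b: "\<bar>c \<alpha>\<bar> * exp (y \<alpha>) \<le> R \<or> 0 \<le> c \<alpha> * exp (y \<alpha>) \<and> \<alpha> = \<beta>"
  proof (cases "\<alpha> = \<beta>")
    case False
    then have "\<alpha> \<in> A - {\<beta>}" using \<alpha> by simp
    then have "c \<alpha> * exp (y \<alpha>) \<le> R"
      unfolding R_def using finite cn by (intro member_le_sum) auto
    then show ?thesis using cn[OF \<open>\<alpha> \<in> A - {\<beta>}\<close>] by simp
  next
    case True
    show ?thesis
    proof (cases "c \<beta> \<ge> 0")
      case False
      then show ?thesis using neg em True by simp
    qed (use True in simp)
  qed
  show ?thesis
  proof (cases "\<bar>c \<alpha>\<bar> * exp (y \<alpha>) \<le> R")
    case True
    then have "(1 - exp (- m)) * (\<bar>c \<alpha>\<bar> * exp (y \<alpha>)) \<le> (1 - exp (- m)) * R"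
      using m by (intro mult_left_mono) auto
    then show ?thesis using neg tot by (simp add: algebra_simps)
  next
    case False
    then have "\<alpha> = \<beta>" "0 \<le> c \<alpha> * exp (y \<alpha>)" using b by auto
    then have "(1 - exp (- m)) * (\<bar>c \<alpha>\<bar> * exp (y \<alpha>)) \<le> c \<beta> * exp (y \<beta>)"
      using m mult_left_le_one_le[of "c \<beta> * exp (y \<beta>)" "1 - exp (- m)"] by (simp add: zero_le_mult_iff)
    then show ?thesis using tot R0 by simp
  qed
qed

lemma AGE_lambda_dual:
  assumes lam: "lam \<in> Lambda_X X A" and c: "c \<in> AGE_lambda X A lam" and y: "dot lam y + sig lam \<ge> 0"
  shows "(\<Sum>\<alpha>\<in>A. c \<alpha> * exp (y \<alpha>)) \<ge> 0"
proof -
  define \<beta> where "\<beta> = neg_idx A lam"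
  note props = circuit_props[OF lam, folded \<beta>_def]
  have cn: "c \<alpha> \<ge> 0" if "\<alpha> \<in> A - {\<beta>}" for \<alpha>
    using c that by (auto simp: AGE_lambda_def \<beta>_def)
  have cP: "c \<alpha> \<ge> 0" if "\<alpha> \<in> A" "lam \<alpha> > 0" for \<alpha>
    using cn[of \<alpha>] props(3) that by (cases "\<alpha> = \<beta>") auto
  let ?S = "\<Sum>\<alpha>\<in>{\<alpha>\<in>A. lam \<alpha> > 0}. c \<alpha> * exp (y \<alpha>)"
  have "?S \<ge> 0" using cP by (intro sum_nonneg) auto
  then have "exp (- (dot lam y + sig lam)) * ?S \<le> ?S"
    using y by (intro mult_left_le_one_le) auto
  then have "- c \<beta> * exp (y \<beta>) \<le> ?S"
    using AGE_lambda_bound[OF lam c, of y] by (simp add: \<beta>_def)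
  also have "?S \<le> (\<Sum>\<alpha>\<in>A-{\<beta>}. c \<alpha> * exp (y \<alpha>))"
    using finite props(3) cn by (intro sum_mono2) auto
  finally show ?thesis using finite props(1) by (simp add: sum.remove)
qed

lemma AGE_lambda_dual_converse:
  assumes lam: "lam \<in> Lambda_X X A"
    and dual: "\<And>c. c \<in> AGE_lambda X A lam \<Longrightarrow> (\<Sum>\<alpha>\<in>A. c \<alpha> * exp (y \<alpha>)) \<ge> 0"
  shows "dot lam y + sig lam \<ge> 0"
proof -
  define \<beta> where "\<beta> = neg_idx A lam"
  note props = circuit_props[OF lam, folded \<beta>_def]
  define P where "P = {\<alpha>\<in>A. lam \<alpha> > 0}"
  have P: "finite P" "P \<subseteq> A" "\<beta> \<notin> P" using finite props(3) by (auto simp: P_def)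
  define w where "w = (\<Sum>\<alpha>\<in>P. lam \<alpha> * y \<alpha>)"
  \<comment> \<open>The equality case of AM-GM: the terms
    \<open>c \<alpha> * exp (y \<alpha>)\<close> equal \<open>lam \<alpha>\<close> and sum to 1,
    while \<open>c \<beta>\<close> is the least value that the product condition allows. The pairing
    is then 1 minus the exponential of \<open>- (dot lam y + sig lam)\<close>.\<close>
  define c where "c = (\<lambda>\<alpha>. if \<alpha> = \<beta> then - exp (- w - sig lam) else lam \<alpha> * exp (- y \<alpha>))"
  have "(\<Prod>\<alpha>\<in>P. (c \<alpha> / lam \<alpha>) powr lam \<alpha>) = exp (\<Sum>\<alpha>\<in>P. lam \<alpha> * ln (c \<alpha> / lam \<alpha>))"
    using P by (intro prod_powr_eq_exp) (auto simp: c_def P_def)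
  also have "(\<Sum>\<alpha>\<in>P. lam \<alpha> * ln (c \<alpha> / lam \<alpha>)) = - w"
    unfolding w_def sum_negf[symmetric] using P(3) by (intro sum.cong) (auto simp: c_def P_def)
  finally have "(\<Prod>\<alpha>\<in>P. (c \<alpha> / lam \<alpha>) powr lam \<alpha>) = - c \<beta> * exp (sig lam)"
    by (simp add: c_def exp_diff)
  then have "c \<in> AGE_lambda X A lam"
    using props(1,5,6) by (auto simp: AGE_lambda_def in_RA_def c_def P_def sig_def simp flip: \<beta>_def)
  then have "0 \<le> (\<Sum>\<alpha>\<in>A. c \<alpha> * exp (y \<alpha>))" by (rule dual)
  also have "\<dots> = c \<beta> * exp (y \<beta>) + (\<Sum>\<alpha>\<in>A-{\<beta>}. lam \<alpha>)"
  proof -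
    have "(\<Sum>\<alpha>\<in>A-{\<beta>}. c \<alpha> * exp (y \<alpha>)) = (\<Sum>\<alpha>\<in>A-{\<beta>}. lam \<alpha>)"
      by (intro sum.cong) (auto simp: c_def exp_minus)
    then show ?thesis using finite props(1) by (simp add: sum.remove)
  qed
  also have "(\<Sum>\<alpha>\<in>A-{\<beta>}. lam \<alpha>) = 1"
    using props(1,2,3) finite by (simp add: Nbeta_def sum.remove)
  also have "c \<beta> * exp (y \<beta>) = - exp (- (dot lam y + sig lam))"
    unfolding props(7) by (simp add: c_def w_def P_def exp_add[symmetric] exp_minus_inverse flip: exp_add)
  finally have "exp (- (dot lam y + sig lam)) \<le> 1" by simp
  then show ?thesis by simp
qed

end

context polyhedral_signomials
begin

section \<open>Feasibility of evaluations and witnessed cones inside the SAGE cone\<close>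

lemma Lambda_X_star_subset: "Lambda_X_star X A \<subseteq> Lambda_X X A"
  by (auto simp: Lambda_X_star_def)

text \<open>Holds because the support function is a supremum over \<open>X\<close>. It turns the
  dual condition into nonnegativity of signomials at points of \<open>X\<close> and supplies the
  perturbations used later.\<close>

lemma circuit_at_point:
  assumes "lam \<in> Lambda_X X A" "x \<in> X"
  shows "dot lam (\<lambda>\<alpha>. \<alpha> \<bullet> x) + sig lam \<ge> 0"
  using circuit_props(4)[OF assms(1)] assms(2) by (force simp: support_epigraph_def Amul_inner)

lemma SAGE_beta_sum:
  assumes "\<And>i. i \<in> I \<Longrightarrow> c i \<in> SAGE_beta X A \<beta>"
  shows "(\<lambda>\<alpha>. \<Sum>i\<in>I. c i \<alpha>) \<in> SAGE_beta X A \<beta>"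
proof -
  have "signomial A (\<lambda>\<alpha>. \<Sum>i\<in>I. c i \<alpha>) x = (\<Sum>i\<in>I. signomial A (c i) x)" for x
    unfolding signomial_def sum_distrib_right by (rule sum.swap)
  then show ?thesis
    using assms by (auto simp: SAGE_beta_def in_RA_def intro!: sum_nonneg)
qed

lemma AGE_lambda_subset_SAGE_beta:
  assumes "lam \<in> Lambda_X X A"
  shows "AGE_lambda X A lam \<subseteq> SAGE_beta X A (neg_idx A lam)"
proof
  fix c assume c: "c \<in> AGE_lambda X A lam"
  have "signomial A c x \<ge> 0" if "x \<in> X" for x
    unfolding signomial_def using AGE_lambda_dual[OF assms c circuit_at_point[OF assms that]] .
  then show "c \<in> SAGE_beta X A (neg_idx A lam)"
    using c by (auto simp: AGE_lambda_def SAGE_beta_def)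
qed

lemma msum_AGE_subset_SAGE:
  assumes "L \<subseteq> Lambda_X X A" "finite L"
  shows "msum L (AGE_lambda X A) \<subseteq> SAGE X A"
proof
  fix c assume "c \<in> msum L (AGE_lambda X A)"
  then obtain cs where cs: "\<And>lam. lam \<in> L \<Longrightarrow> cs lam \<in> AGE_lambda X A lam" "c = (\<lambda>\<alpha>. \<Sum>lam\<in>L. cs lam \<alpha>)"
    by (auto simp: msum_def)
  \<comment> \<open>Summands are regrouped by negative index; an index without circuits receives the
    zero vector.\<close>
  define ds where "ds = (\<lambda>\<beta> \<alpha>. \<Sum>lam\<in>{lam\<in>L. neg_idx A lam = \<beta>}. cs lam \<alpha>)"
  have "ds \<beta> \<in> SAGE_beta X A \<beta>" for \<beta>
    unfolding ds_def using cs(1) AGE_lambda_subset_SAGE_beta assms by (intro SAGE_beta_sum) blast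
  moreover have "c \<alpha> = (\<Sum>\<beta>\<in>A. ds \<beta> \<alpha>)" for \<alpha>
    unfolding ds_def cs(2) using assms finite circuit_props(1) by (intro sum.group[symmetric]) auto
  ultimately show "c \<in> SAGE X A"
    unfolding SAGE_def msum_def by blast
qed

lemma SAGE_signomial_nonneg:
  assumes "c \<in> SAGE X A" "x \<in> X"
  shows "signomial A c x \<ge> 0"
proof -
  obtain cs where cs: "\<And>\<beta>. \<beta> \<in> A \<Longrightarrow> cs \<beta> \<in> SAGE_beta X A \<beta>" "c = (\<lambda>\<alpha>. \<Sum>\<beta>\<in>A. cs \<beta> \<alpha>)"
    using assms(1) by (auto simp: SAGE_def msum_def)
  have "signomial A c x = (\<Sum>\<beta>\<in>A. signomial A (cs \<beta>) x)"
    unfolding signomial_def cs(2) sum_distrib_right by (rule sum.swap)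
  then show ?thesis
    using cs(1) assms(2) by (auto simp: SAGE_beta_def intro!: sum_nonneg)
qed

section \<open>Closedness and separation\<close>

text \<open>Pointedness keeps \<open>- p\<close> out of the cone for each generator
  \<open>p\<close>, so some functional is nonnegative on the cone and positive at \<open>p\<close>;
  the sum of these is positive on all generators. Positivity on \<open>(0, 1)\<close> permits
  normalising the last entry to 1.\<close>

lemma strictly_feasible_point:
  obtains y where "\<And>lam. lam \<in> Lambda_X_star X A \<Longrightarrow> dot lam y + sig lam > 0"
proof -
  define T where "T = funform X A ` Lambda_X_star X A \<union> {(0, 1)}"
  have finT: "finite T" using finite_Lambda_X_star by (simp add: T_def)
  have inRA: "in_RA A (fst s)" if "s \<in> T" for s
    using that circuit_props(5) Lambda_X_star_subset by (auto simp: T_def funform_eq in_RA_def)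
  have "\<exists>q. (\<forall>s\<in>T. dot (fst s) (fst q) + snd s * snd q \<ge> 0) \<and> dot (fst p) (fst q) + snd p * snd q > 0"
    if p: "p \<in> T" for p
  proof -
    have not_in: "- p \<notin> convex_cone hull T"
    proof
      assume "- p \<in> convex_cone hull T"
      then obtain t where t: "- p = (\<Sum>s\<in>T. t s *\<^sub>R s)" "\<forall>s\<in>T. 0 \<le> t s"
        using finT by (auto simp: convex_cone_hull_finite)
      \<comment> \<open>Adding \<open>p\<close> itself to a representation of \<open>- p\<close>
        would represent 0 with a positive coefficient at \<open>p\<close>.\<close>
      let ?t = "\<lambda>s. t s + (if s = p then 1 else 0)"
      have "(\<Sum>s\<in>T. ?t s *\<^sub>R s) = - p + (\<Sum>s\<in>T. (if s = p then 1 else 0) *\<^sub>R s)"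
        by (simp add: t(1) scaleR_add_left sum.distrib)
      also have "(\<Sum>s\<in>T. (if s = p then 1 else 0) *\<^sub>R s) = p"
        using finT p by (simp add: if_distrib[of "\<lambda>r. r *\<^sub>R _"] sum.delta' cong: if_cong)
      finally have "(\<Sum>s\<in>T. ?t s *\<^sub>R s) = 0" by simp
      then have "\<forall>s\<in>T. ?t s = 0"
        unfolding T_def using t(2)
        by (intro circuits_pointed[OF finite_Lambda_X_star Lambda_X_star_subset]) (auto simp: T_def)
      then have "t p + 1 = 0" using p by auto
      then show False using t(2) p by fastforce
    qed
    have "in_RA A (fst (- p))" using inRA[OF p] by (simp add: in_RA_def)
    then obtain y r where "\<forall>s\<in>T. dot (fst s) y + snd s * r \<ge> 0" "dot (fst (- p)) y + snd (- p) * r < 0"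
      using farkas_separation[OF finite finT inRA _ not_in] by blast
    then show ?thesis by (intro exI[of _ "(y, r)"]) (auto simp: sum_negf)
  qed
  then have "\<forall>p\<in>T. \<exists>q. (\<forall>s\<in>T. dot (fst s) (fst q) + snd s * snd q \<ge> 0) \<and> dot (fst p) (fst q) + snd p * snd q > 0"
    by blast
  from bchoice[OF this] obtain q
    where q: "\<forall>p\<in>T. (\<forall>s\<in>T. dot (fst s) (fst (q p)) + snd s * snd (q p) \<ge> 0) \<and> dot (fst p) (fst (q p)) + snd p * snd (q p) > 0"
    by blast
  define y where "y = (\<lambda>\<alpha>. \<Sum>p\<in>T. fst (q p) \<alpha>)"
  define r where "r = (\<Sum>p\<in>T. snd (q p))"
  have pos: "dot (fst s) y + snd s * r > 0" if s: "s \<in> T" for s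
  proof -
    have "dot (fst s) y + snd s * r = (\<Sum>p\<in>T. dot (fst s) (fst (q p)) + snd s * snd (q p))"
      unfolding y_def r_def sum_distrib_left sum.distrib by (subst sum.swap) simp
    also have "\<dots> > 0" using finT s q by (intro sum_pos2[of T s]) auto
    finally show ?thesis .
  qed
  have r: "r > 0" using pos[of "(0, 1)"] by (simp add: T_def)
  show thesis
  proof (rule that[of "\<lambda>\<alpha>. y \<alpha> / r"])
    fix lam assume "lam \<in> Lambda_X_star X A"
    then have "dot lam y + sig lam * r > 0"
      using pos[of "funform X A lam"] by (simp add: T_def funform_eq)
    moreover have "dot lam (\<lambda>\<alpha>. y \<alpha> / r) + sig lam = (dot lam y + sig lam * r) / r"
      using r by (simp add: sum_divide_distrib add_divide_distrib)
    ultimately show "dot lam (\<lambda>\<alpha>. y \<alpha> / r) + sig lam > 0" using r by simp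
  qed
qed

abbreviation reduced_sum :: "('a \<Rightarrow> real) set" where
  "reduced_sum \<equiv> msum (Lambda_X_star X A) (AGE_lambda X A)"

lemma convex_cone_reduced_sum: "convex_cone reduced_sum"
proof (rule convex_coneI)
  have "0 \<in> AGE_lambda X A lam" if "lam \<in> Lambda_X_star X A" for lam
    using that Lambda_X_star_subset by (intro AGE_lambda_nonneg) (auto simp: in_RA_def)
  then show "0 \<in> reduced_sum"
    by (auto simp: msum_def fun_eq_iff intro!: exI[of _ "\<lambda>_. 0"])
  show "c + d \<in> reduced_sum" if cd: "c \<in> reduced_sum" "d \<in> reduced_sum" for c d
  proof -
    obtain cs where cs: "\<And>lam. lam \<in> Lambda_X_star X A \<Longrightarrow> cs lam \<in> AGE_lambda X A lam" "c = (\<lambda>\<alpha>. \<Sum>lam\<in>Lambda_X_star X A. cs lam \<alpha>)"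
      using cd(1) by (auto simp: msum_def)
    obtain ds where ds: "\<And>lam. lam \<in> Lambda_X_star X A \<Longrightarrow> ds lam \<in> AGE_lambda X A lam" "d = (\<lambda>\<alpha>. \<Sum>lam\<in>Lambda_X_star X A. ds lam \<alpha>)"
      using cd(2) by (auto simp: msum_def)
    have "\<forall>lam\<in>Lambda_X_star X A. cs lam + ds lam \<in> AGE_lambda X A lam"
      using cs(1) ds(1) Lambda_X_star_subset AGE_lambda_add by blast
    moreover have "c + d = (\<lambda>\<alpha>. \<Sum>lam\<in>Lambda_X_star X A. (cs lam + ds lam) \<alpha>)"
      by (simp add: cs(2) ds(2) fun_eq_iff sum.distrib)
    ultimately show ?thesis unfolding msum_def by (intro CollectI exI[of _ "\<lambda>lam. cs lam + ds lam"] conjI)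
  qed
  show "k *\<^sub>R c \<in> reduced_sum" if kc: "0 \<le> k" "c \<in> reduced_sum" for k c
  proof -
    obtain cs where cs: "\<And>lam. lam \<in> Lambda_X_star X A \<Longrightarrow> cs lam \<in> AGE_lambda X A lam" "c = (\<lambda>\<alpha>. \<Sum>lam\<in>Lambda_X_star X A. cs lam \<alpha>)"
      using kc(2) by (auto simp: msum_def)
    have "\<forall>lam\<in>Lambda_X_star X A. k *\<^sub>R cs lam \<in> AGE_lambda X A lam"
      using cs(1) kc(1) Lambda_X_star_subset AGE_lambda_scaleR by blast
    moreover have "k *\<^sub>R c = (\<lambda>\<alpha>. \<Sum>lam\<in>Lambda_X_star X A. (k *\<^sub>R cs lam) \<alpha>)"
      by (simp add: cs(2) fun_eq_iff sum_distrib_left)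
    ultimately show ?thesis unfolding msum_def by (intro CollectI exI[of _ "\<lambda>lam. k *\<^sub>R cs lam"] conjI)
  qed
qed

lemma AGE_lambda_subset_reduced_sum:
  assumes "lam \<in> Lambda_X_star X A" "c \<in> AGE_lambda X A lam"
  shows "c \<in> reduced_sum"
proof -
  let ?cs = "\<lambda>mu. if mu = lam then c else 0"
  have "\<forall>mu\<in>Lambda_X_star X A. ?cs mu \<in> AGE_lambda X A mu"
    using assms(2) Lambda_X_star_subset by (auto intro!: AGE_lambda_nonneg simp: in_RA_def)
  moreover have "c = (\<lambda>\<alpha>. \<Sum>mu\<in>Lambda_X_star X A. ?cs mu \<alpha>)"
    using assms(1) finite_Lambda_X_star
    by (intro ext) (simp add: if_distrib[of "\<lambda>f. f _"] sum.delta cong: if_cong)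
  ultimately show ?thesis unfolding msum_def by (intro CollectI exI[of _ ?cs] conjI)
qed

lemma in_RA_reduced_sum: "c \<in> reduced_sum \<Longrightarrow> in_RA A c"
  by (auto simp: msum_def in_RA_def AGE_lambda_def)

text \<open>A strictly feasible \<open>y\<close> makes \<open>c \<mapsto> \<Sum> c\<^sub>\<alpha> e\<^sup>y\<^sup>\<alpha>\<close> coercive on every summand,
  so near-optimal decompositions stay in a compact set.\<close>

lemma closest_point_reduced_sum:
  obtains s where "s \<in> reduced_sum" "\<And>u. u \<in> reduced_sum \<Longrightarrow> (\<Sum>\<alpha>\<in>A. (c \<alpha> - s \<alpha>)\<^sup>2) \<le> (\<Sum>\<alpha>\<in>A. (c \<alpha> - u \<alpha>)\<^sup>2)"
proof -
  define L where "L = Lambda_X_star X A"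
  have L: "finite L" "L \<subseteq> Lambda_X X A"
    using finite_Lambda_X_star Lambda_X_star_subset by (auto simp: L_def)
  obtain y where y: "\<And>lam. lam \<in> L \<Longrightarrow> dot lam y + sig lam > 0"
    using strictly_feasible_point unfolding L_def by blast
  \<comment> \<open>A uniform margin; \<open>insert 1\<close> covers the case of an empty
    \<open>L\<close>.\<close>
  obtain m where m: "m > 0" "\<And>lam. lam \<in> L \<Longrightarrow> m \<le> dot lam y + sig lam"
  proof
    show "Min (insert 1 ((\<lambda>lam. dot lam y + sig lam) ` L)) > 0"
      using L(1) y by (subst Min_gr_iff) auto
    show "Min (insert 1 ((\<lambda>lam. dot lam y + sig lam) ` L)) \<le> dot lam y + sig lam" if "lam \<in> L" for lam
      using L(1) that by (intro Min_le) auto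
  qed
  define \<delta> where "\<delta> = 1 - exp (- m)"
  have \<delta>: "\<delta> > 0" using m(1) by (simp add: \<delta>_def)
  define tot where "tot = (\<lambda>(cs :: ('a \<Rightarrow> real) \<Rightarrow> 'a \<Rightarrow> real) \<alpha>. \<Sum>lam\<in>L. cs lam \<alpha>)"
  define D where "D = (\<lambda>cs. \<Sum>\<alpha>\<in>A. (c \<alpha> - tot cs \<alpha>)\<^sup>2)"
  \<comment> \<open>The zero family is admissible, so it is enough to consider families no farther
    from \<open>c\<close> than it; each coordinate of their total is within \<open>r\<close> of that
    of \<open>c\<close>.\<close>
  define r where "r = sqrt (D 0)"
  define B where "B = (\<Sum>\<alpha>\<in>A. (\<bar>c \<alpha>\<bar> + r) * exp (y \<alpha>))"
  have bound: "\<bar>cs lam \<alpha>\<bar> \<le> B / (\<delta> * exp (y \<alpha>))"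
    if cs: "\<And>lam. lam \<in> L \<Longrightarrow> cs lam \<in> AGE_lambda X A lam" and D: "D cs \<le> D 0" and "lam \<in> L" "\<alpha> \<in> A" for cs lam \<alpha>
  proof -
    have coer: "\<delta> * (\<bar>cs lam \<alpha>\<bar> * exp (y \<alpha>)) \<le> (\<Sum>\<alpha>\<in>A. cs lam \<alpha> * exp (y \<alpha>))" if "lam \<in> L" "\<alpha> \<in> A" for lam \<alpha>
      unfolding \<delta>_def using that cs L(2) m by (intro AGE_lambda_coercive) auto
    have nn: "0 \<le> (\<Sum>\<alpha>\<in>A. cs lam \<alpha> * exp (y \<alpha>))" if "lam \<in> L" for lam
      using coer[OF that \<open>\<alpha> \<in> A\<close>] \<delta> by (meson abs_ge_zero exp_ge_zero less_imp_le mult_nonneg_nonneg order_trans)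
    have "(\<Sum>\<alpha>\<in>A. cs lam \<alpha> * exp (y \<alpha>)) \<le> (\<Sum>lam\<in>L. \<Sum>\<alpha>\<in>A. cs lam \<alpha> * exp (y \<alpha>))"
      using L(1) \<open>lam \<in> L\<close> nn by (intro member_le_sum[where f = "\<lambda>lam. \<Sum>\<alpha>\<in>A. cs lam \<alpha> * exp (y \<alpha>)"]) auto
    also have "\<dots> = (\<Sum>\<alpha>\<in>A. tot cs \<alpha> * exp (y \<alpha>))"
      unfolding tot_def sum_distrib_right by (rule sum.swap)
    also have "\<dots> \<le> B"
      unfolding B_def
    proof (intro sum_mono mult_right_mono)
      fix \<alpha> assume "\<alpha> \<in> A"
      then have "(c \<alpha> - tot cs \<alpha>)\<^sup>2 \<le> D cs"
        unfolding D_def using finite by (intro member_le_sum[where f = "\<lambda>\<alpha>. (c \<alpha> - tot cs \<alpha>)\<^sup>2"]) auto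
      then have "\<bar>c \<alpha> - tot cs \<alpha>\<bar> \<le> r"
        using D unfolding r_def by (metis order_trans real_sqrt_abs real_sqrt_le_mono)
      then show "tot cs \<alpha> \<le> \<bar>c \<alpha>\<bar> + r" by linarith
    qed simp
    finally have "\<delta> * (\<bar>cs lam \<alpha>\<bar> * exp (y \<alpha>)) \<le> B" using coer[OF \<open>lam \<in> L\<close> \<open>\<alpha> \<in> A\<close>] by simp
    then show ?thesis using \<delta> by (simp add: pos_le_divide_eq mult.commute mult.left_commute)
  qed
  \<comment> \<open>Families range over the whole function type, so the coordinates outside
    \<open>L\<close> and \<open>A\<close> are pinned to 0; this changes no total and makes every
    factor of the box compact.\<close>
  define K where "K = (\<lambda>lam \<alpha>. if lam \<in> L \<and> \<alpha> \<in> A then {- (B / (\<delta> * exp (y \<alpha>))) .. B / (\<delta> * exp (y \<alpha>))} else {0})"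
  define Z where "Z = {cs. \<forall>lam. cs lam \<in> {f. \<forall>\<alpha>. f \<alpha> \<in> K lam \<alpha>}} \<inter> {cs. \<forall>lam. lam \<in> L \<longrightarrow> cs lam \<in> AGE_lambda X A lam}"
  have "compact {cs. \<forall>lam. cs lam \<in> {f. \<forall>\<alpha>. f \<alpha> \<in> K lam \<alpha>}}"
    by (intro compact_box) (simp add: K_def)
  moreover have "closed {cs :: ('a \<Rightarrow> real) \<Rightarrow> 'a \<Rightarrow> real. cs lam \<in> AGE_lambda X A lam}" if "lam \<in> L" for lam
    using closed_vimage[OF closed_AGE_lambda[of lam] continuous_on_product_coordinates[of lam]] that L(2)
    by (auto simp: vimage_def)
  then have "closed {cs. \<forall>lam. lam \<in> L \<longrightarrow> cs lam \<in> AGE_lambda X A lam}"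
    by (intro closed_Collect_all) (case_tac "lam \<in> L"; simp)
  ultimately have compact: "compact Z"
    unfolding Z_def by (rule compact_Int_closed)
  have zero: "0 \<in> AGE_lambda X A lam" if "lam \<in> L" for lam
    using that L(2) by (intro AGE_lambda_nonneg) (auto simp: in_RA_def)
  have inZ: "(\<lambda>lam. if lam \<in> L then cs lam else 0) \<in> Z"
    if "\<And>lam. lam \<in> L \<Longrightarrow> cs lam \<in> AGE_lambda X A lam" "D cs \<le> D 0" for cs
  proof -
    have "cs lam \<alpha> = 0" if "lam \<in> L" "\<alpha> \<notin> A" for lam \<alpha>
      using \<open>\<And>lam. lam \<in> L \<Longrightarrow> cs lam \<in> AGE_lambda X A lam\<close>[OF that(1)] that(2) by (simp add: AGE_lambda_def in_RA_def)
    then show ?thesis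
      using bound[OF that] that by (auto simp: Z_def K_def abs_le_iff minus_le_iff)
  qed
  have "(\<lambda>lam. if lam \<in> L then 0 lam else 0) \<in> Z" by (rule inZ[OF _ order_refl]) (use zero in simp)
  then have "Z \<noteq> {}" by blast
  have coord: "continuous_on Z (\<lambda>cs. cs lam \<alpha>)" for lam \<alpha>
    by (rule continuous_on_product_then_coordinatewise[OF continuous_on_product_then_coordinatewise[OF continuous_on_id]])
  have "continuous_on Z D"
    unfolding D_def tot_def by (intro continuous_intros coord)
  then obtain cs where cs: "cs \<in> Z" "\<And>u. u \<in> Z \<Longrightarrow> D cs \<le> D u"
    using continuous_attains_inf[OF compact \<open>Z \<noteq> {}\<close>] by blast
  have restrict: "D (\<lambda>lam. if lam \<in> L then u lam else 0) = D u" for u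
    by (simp add: D_def tot_def)
  have min: "D cs \<le> D u" if "\<And>lam. lam \<in> L \<Longrightarrow> u lam \<in> AGE_lambda X A lam" for u
  proof (cases "D u \<le> D 0")
    case True
    then show ?thesis using cs(2)[OF inZ[of u]] that restrict[of u] by simp
  next
    case False
    have "D cs \<le> D 0" using cs(2)[OF inZ[of 0]] zero restrict[of 0] by simp
    then show ?thesis using False by simp
  qed
  show thesis
  proof (rule that[of "tot cs"])
    show "tot cs \<in> reduced_sum"
      using cs(1) unfolding Z_def msum_def L_def[symmetric] tot_def by blast
    fix u assume "u \<in> reduced_sum"
    then obtain us where "\<And>lam. lam \<in> L \<Longrightarrow> us lam \<in> AGE_lambda X A lam" "u = tot us"
      unfolding msum_def L_def[symmetric] tot_def by blast
    then show "(\<Sum>\<alpha>\<in>A. (c \<alpha> - tot cs \<alpha>)\<^sup>2) \<le> (\<Sum>\<alpha>\<in>A. (c \<alpha> - u \<alpha>)\<^sup>2)"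
      using min[of us] by (simp add: D_def)
  qed
qed

text \<open>First-order conditions at the closest point \<open>s\<close>: moving along a cone
  element or along \<open>- s\<close> cannot reduce the distance, so \<open>d = c - s\<close> pairs
  nonpositively with the cone and nonnegatively with \<open>s\<close>. The functional is
  \<open>- d\<close>.\<close>

lemma separate_from_reduced_sum:
  assumes "in_RA A c" "c \<notin> reduced_sum"
  obtains v where "\<And>s. s \<in> reduced_sum \<Longrightarrow> dot s v \<ge> 0" "dot c v < 0"
proof -
  obtain s where s: "s \<in> reduced_sum"
    and min: "\<And>u. u \<in> reduced_sum \<Longrightarrow> (\<Sum>\<alpha>\<in>A. (c \<alpha> - s \<alpha>)\<^sup>2) \<le> (\<Sum>\<alpha>\<in>A. (c \<alpha> - u \<alpha>)\<^sup>2)"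
    using closest_point_reduced_sum[of c] by metis
  define d where "d = c - s"
  have key: "2 * dot u d \<le> t * (\<Sum>\<alpha>\<in>A. (u \<alpha>)\<^sup>2)" if "s + t *\<^sub>R u \<in> reduced_sum" "0 < t" for t u
  proof -
    have "(\<Sum>\<alpha>\<in>A. (c \<alpha> - (s + t *\<^sub>R u) \<alpha>)\<^sup>2) = (\<Sum>\<alpha>\<in>A. (d \<alpha>)\<^sup>2 - t * (2 * (u \<alpha> * d \<alpha>)) + t * (t * (u \<alpha>)\<^sup>2))"
      by (intro sum.cong) (auto simp: d_def power2_eq_square algebra_simps)
    also have "\<dots> = (\<Sum>\<alpha>\<in>A. (d \<alpha>)\<^sup>2) - t * (2 * dot u d) + t * (t * (\<Sum>\<alpha>\<in>A. (u \<alpha>)\<^sup>2))"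
      by (simp add: sum.distrib sum_subtractf sum_distrib_left)
    finally have "t * (2 * dot u d) \<le> t * (t * (\<Sum>\<alpha>\<in>A. (u \<alpha>)\<^sup>2))"
      using min[OF that(1)] by (simp add: d_def)
    then show ?thesis using that(2) by simp
  qed
  have le: "dot u d \<le> 0" if "u \<in> reduced_sum" for u
  proof -
    have "2 * dot u d \<le> t * (\<Sum>\<alpha>\<in>A. (u \<alpha>)\<^sup>2)" if "0 < t" for t
      using that \<open>u \<in> reduced_sum\<close> s convex_cone_reduced_sum
      by (intro key convex_cone_add convex_cone_scaleR) auto
    then show ?thesis using nonpos_if_le_multiples[of "2 * dot u d" "\<Sum>\<alpha>\<in>A. (u \<alpha>)\<^sup>2"] by simp
  qed
  \<comment> \<open>Along \<open>- s\<close> the moved point is \<open>(1 - t) *\<^sub>R s\<close>,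
    guaranteed to stay in the cone for \<open>t\<close> up to 1.\<close>
  have "2 * dot (- s) d \<le> t * (\<Sum>\<alpha>\<in>A. ((- s) \<alpha>)\<^sup>2)" if "0 < t" "t \<le> 1" for t
  proof (rule key)
    have "(1 - t) *\<^sub>R s \<in> reduced_sum"
      using that s by (intro convex_cone_scaleR[OF convex_cone_reduced_sum]) auto
    then show "s + t *\<^sub>R - s \<in> reduced_sum" by (simp add: scaleR_diff_left)
  qed (rule that)
  then have "2 * dot (- s) d \<le> 0" by (rule nonpos_if_le_multiples)
  then have sd: "dot s d \<ge> 0" by (simp add: sum_negf)
  have "\<exists>\<alpha>\<in>A. d \<alpha> \<noteq> 0"
  proof (rule ccontr)
    assume "\<not> (\<exists>\<alpha>\<in>A. d \<alpha> \<noteq> 0)"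
    then have "c \<alpha> = s \<alpha>" for \<alpha>
      using assms(1) in_RA_reduced_sum[OF s] by (cases "\<alpha> \<in> A") (auto simp: d_def in_RA_def)
    then have "c = s" by (rule ext)
    then show False using s assms(2) by simp
  qed
  then have "dot d d > 0" using finite by (auto intro!: sum_pos2 simp: zero_less_mult_iff linorder_neq_iff)
  moreover have "dot c d = dot d d + dot s d"
    unfolding sum.distrib[symmetric] by (intro sum.cong) (auto simp: d_def algebra_simps)
  ultimately have "dot c d > 0" using sd by simp
  then show thesis using le by (intro that[of "- d"]) (auto simp: sum_negf)
qed

section \<open>The decomposition\<close>

text \<open>If the system for \<open>x\<close> were infeasible, its Farkas multipliers, on the
  inequalities of \<open>X\<close> and on the differences, would assemble into a point of the
  epigraph at which \<open>(y, 1)\<close> is negative.\<close>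

lemma AGE_point_below:
  assumes \<beta>: "\<beta> \<in> A" and y: "\<And>\<nu> \<tau>. (\<nu>, \<tau>) \<in> epi \<beta> \<Longrightarrow> dot \<nu> y + \<tau> \<ge> 0"
  obtains x where "x \<in> X" "\<And>\<alpha>. \<alpha> \<in> A \<Longrightarrow> \<alpha> \<bullet> x - \<beta> \<bullet> x \<le> y \<alpha> - y \<beta>"
proof -
  obtain P where P: "finite P" "X = {x. \<forall>p\<in>P. fst p \<bullet> x \<le> snd p}"
    using polyhedron_inequalities[OF polyhedron] by blast
  define a where "a = case_sum (fst :: 'a \<times> real \<Rightarrow> 'a) (\<lambda>\<alpha>. \<alpha> - \<beta>)"
  define b where "b = case_sum (snd :: 'a \<times> real \<Rightarrow> real) (\<lambda>\<alpha>. y \<alpha> - y \<beta>)"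
  have "\<exists>x. \<forall>i\<in>P <+> A. a i \<bullet> x \<le> b i"
  proof (rule ccontr)
    assume none: "\<not> (\<exists>x. \<forall>i\<in>P <+> A. a i \<bullet> x \<le> b i)"
    obtain t where t: "\<And>i. i \<in> P <+> A \<Longrightarrow> t i \<ge> 0" "(\<Sum>i\<in>P <+> A. t i *\<^sub>R a i) = 0" "(\<Sum>i\<in>P <+> A. t i * b i) < 0"
      by (rule farkas_infeasible[OF finite_Plus[OF P(1) finite] none]) blast
    define \<kappa> where "\<kappa> = (\<lambda>p. t (Inl p))"
    define \<mu> where "\<mu> = (\<lambda>\<alpha>. t (Inr \<alpha>))"
    have t1: "(\<Sum>p\<in>P. \<kappa> p *\<^sub>R fst p) + (\<Sum>\<alpha>\<in>A. \<mu> \<alpha> *\<^sub>R (\<alpha> - \<beta>)) = 0"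
      using t(2) P(1) finite by (simp add: sum.Plus a_def \<kappa>_def \<mu>_def)
    have t2: "(\<Sum>p\<in>P. \<kappa> p * snd p) + (\<Sum>\<alpha>\<in>A. \<mu> \<alpha> * (y \<alpha> - y \<beta>)) < 0"
      using t(3) P(1) finite by (simp add: sum.Plus b_def \<kappa>_def \<mu>_def)
    have nn: "\<And>p. p \<in> P \<Longrightarrow> \<kappa> p \<ge> 0" "\<And>\<alpha>. \<alpha> \<in> A \<Longrightarrow> \<mu> \<alpha> \<ge> 0"
      using t(1) by (auto simp: \<kappa>_def \<mu>_def)
    define M where "M = (\<Sum>\<alpha>\<in>A. \<mu> \<alpha>)"
    \<comment> \<open>Charging the total \<open>M\<close> to \<beta> gives zero sum. The row of
      \<beta> in the system reads 0 \<le> 0, so its own multiplier cancels.\<close>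
    define \<nu> where "\<nu> = (\<lambda>\<alpha>. if \<alpha> \<in> A then \<mu> \<alpha> - (if \<alpha> = \<beta> then M else 0) else 0)"
    define \<tau> where "\<tau> = (\<Sum>p\<in>P. \<kappa> p * snd p)"
    have sum\<nu>: "(\<Sum>\<alpha>\<in>A. \<nu> \<alpha> * f \<alpha>) = (\<Sum>\<alpha>\<in>A. \<mu> \<alpha> * f \<alpha>) - M * f \<beta>" for f :: "'a \<Rightarrow> real"
    proof -
      have "(\<Sum>\<alpha>\<in>A. \<nu> \<alpha> * f \<alpha>) = (\<Sum>\<alpha>\<in>A. \<mu> \<alpha> * f \<alpha> - (if \<alpha> = \<beta> then M * f \<beta> else 0))"
        by (intro sum.cong) (auto simp: \<nu>_def algebra_simps)
      then show ?thesis using finite \<beta> by (simp add: sum_subtractf)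
    qed
    have "\<nu> \<in> Nbeta A \<beta>"
      using nn sum\<nu>[of "\<lambda>_. 1"] by (auto simp: Nbeta_def in_RA_def M_def \<nu>_def)
    moreover have "- Amul A \<nu> \<bullet> x \<le> \<tau>" if "x \<in> X" for x
    proof -
      have "Amul A \<nu> \<bullet> x = (\<Sum>\<alpha>\<in>A. \<mu> \<alpha> * (\<alpha> \<bullet> x)) - M * (\<beta> \<bullet> x)"
        unfolding Amul_inner by (rule sum\<nu>)
      also have "\<dots> = (\<Sum>\<alpha>\<in>A. \<mu> \<alpha> *\<^sub>R (\<alpha> - \<beta>)) \<bullet> x"
        by (simp add: inner_sum_left M_def sum_distrib_right algebra_simps sum_subtractf inner_diff_left)
      also have "\<dots> = - (\<Sum>p\<in>P. \<kappa> p *\<^sub>R fst p) \<bullet> x"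
        using t1 by (metis add_eq_0_iff)
      finally have "- Amul A \<nu> \<bullet> x = (\<Sum>p\<in>P. \<kappa> p * (fst p \<bullet> x))"
        by (simp add: inner_sum_left)
      also have "\<dots> \<le> \<tau>"
        unfolding \<tau>_def using nn(1) that P(2) by (intro sum_mono mult_left_mono) auto
      finally show ?thesis .
    qed
    ultimately have "(\<nu>, \<tau>) \<in> epi \<beta>" by (simp add: support_epigraph_def)
    then have "dot \<nu> y + \<tau> \<ge> 0" by (rule y)
    moreover have "dot \<nu> y = (\<Sum>\<alpha>\<in>A. \<mu> \<alpha> * (y \<alpha> - y \<beta>))"
      unfolding sum\<nu> by (simp add: M_def algebra_simps sum_subtractf sum_distrib_left)
    ultimately show False using t2 by (simp add: \<tau>_def)
  qed
  then obtain x where x: "\<And>i. i \<in> P <+> A \<Longrightarrow> a i \<bullet> x \<le> b i" by blast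
  show thesis
  proof (rule that[of x])
    show "x \<in> X" using x[of "Inl _"] by (auto simp: P(2) a_def b_def)
    show "\<alpha> \<bullet> x - \<beta> \<bullet> x \<le> y \<alpha> - y \<beta>" if "\<alpha> \<in> A" for \<alpha>
      using x[of "Inr \<alpha>"] that by (auto simp: a_def b_def inner_diff_left)
  qed
qed

lemma circuit_graph_dual:
  assumes y: "\<And>lam. lam \<in> Lambda_X_star X A \<Longrightarrow> dot lam y + sig lam \<ge> 0" and p: "p \<in> circuit_graph X A"
  shows "dot (fst p) y + snd p \<ge> 0"
proof -
  have "convex_cone {p. dot (fst p) y + snd p \<ge> 0}"
  proof (rule convex_coneI)
    show "p + q \<in> {p. dot (fst p) y + snd p \<ge> 0}"
      if "p \<in> {p. dot (fst p) y + snd p \<ge> 0}" "q \<in> {p. dot (fst p) y + snd p \<ge> 0}" for p q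
      using that by (simp add: algebra_simps sum.distrib)
    show "k *\<^sub>R p \<in> {p. dot (fst p) y + snd p \<ge> 0}"
      if "0 \<le> k" "p \<in> {p. dot (fst p) y + snd p \<ge> 0}" for k p
    proof -
      have "dot (fst (k *\<^sub>R p)) y + snd (k *\<^sub>R p) = k * (dot (fst p) y + snd p)"
        by (simp add: algebra_simps sum_distrib_left)
      then show ?thesis using that by simp
    qed
  qed simp
  then have "convex_cone hull (funform X A ` Lambda_X_star X A \<union> {(0, 1)}) \<subseteq> {p. dot (fst p) y + snd p \<ge> 0}"
    using y by (intro hull_minimal) (auto simp: funform_eq)
  then show ?thesis using p circuit_graph_reduced by blast
qed

text \<open>Without reduced circuits the circuit graph would be the vertical ray, which contains no
  functional form of a circuit. A reduced circuit is what brings the nonnegative vectors into the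
  Minkowski sum, whose empty instance is the zero vector alone.\<close>

lemma Lambda_X_star_nonempty:
  assumes "Lambda_X X A \<noteq> {}"
  shows "Lambda_X_star X A \<noteq> {}"
proof
  assume empty: "Lambda_X_star X A = {}"
  obtain lam where lam: "lam \<in> Lambda_X X A" using assms by blast
  have "(lam, sig lam) \<in> circuit_graph X A"
    using circuit_props(1,4)[OF lam] epi_subset_circuit_graph by blast
  then have "(lam, sig lam) \<in> convex_cone hull {(0, 1)}"
    using circuit_graph_reduced empty by simp
  then have "lam = 0" by (auto simp: convex_cone_hull_finite)
  then show False using circuit_props(3)[OF lam] by simp
qed

lemma SAGE_beta_subset_reduced_sum:
  assumes ne: "Lambda_X X A \<noteq> {}" and \<beta>: "\<beta> \<in> A"
  shows "SAGE_beta X A \<beta> \<subseteq> reduced_sum"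
proof
  fix c assume c: "c \<in> SAGE_beta X A \<beta>"
  show "c \<in> reduced_sum"
  proof (rule ccontr)
    assume "c \<notin> reduced_sum"
    then obtain v where v: "\<And>s. s \<in> reduced_sum \<Longrightarrow> dot s v \<ge> 0" "dot c v < 0"
      using separate_from_reduced_sum[of c] c by (auto simp: SAGE_beta_def)
    obtain lam where lam: "lam \<in> Lambda_X_star X A" using Lambda_X_star_nonempty[OF ne] by blast
    \<comment> \<open>Unit vectors lie in every witnessed cone, so the separating functional has
      nonnegative entries.\<close>
    have vn: "v \<alpha> \<ge> 0" if "\<alpha> \<in> A" for \<alpha>
    proof -
      let ?e = "\<lambda>\<gamma>. if \<gamma> = \<alpha> then 1 else 0"
      have "?e \<in> AGE_lambda X A lam"
        using lam Lambda_X_star_subset that by (intro AGE_lambda_nonneg) (auto simp: in_RA_def)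
      then have "dot ?e v \<ge> 0"
        using v(1) AGE_lambda_subset_reduced_sum[OF lam] by blast
      then show ?thesis
        using that finite by (simp add: if_distrib[of "\<lambda>r. r * _"] cong: if_cong)
    qed
    obtain x0 where x0: "x0 \<in> X" using nonempty by blast
    \<comment> \<open>\<open>v\<close> may have zero entries and then has no logarithm. Adding
      \<epsilon> times the exponentials at \<open>x0\<close> makes all entries positive and keeps
      nonnegativity on the sum, whose signomials are nonnegative at \<open>x0\<close>; \<epsilon> is
      chosen so that the pairing with \<open>c\<close> gains at most \<open>- dot c v / 2\<close>.
      The summand 1 keeps the divisor positive.\<close>
    define N where "N = \<bar>signomial A c x0\<bar> + 1"
    have N: "N > 0" by (simp add: N_def add_nonneg_pos)
    define \<epsilon> where "\<epsilon> = - dot c v / (2 * N)"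
    have \<epsilon>: "\<epsilon> > 0" using v(2) N unfolding \<epsilon>_def by (intro divide_pos_pos) auto
    define w where "w = (\<lambda>\<alpha>. v \<alpha> + \<epsilon> * exp (\<alpha> \<bullet> x0))"
    define y where "y = (\<lambda>\<alpha>. ln (w \<alpha>))"
    have w: "w \<alpha> > 0" if "\<alpha> \<in> A" for \<alpha> using vn[OF that] \<epsilon> by (auto simp: w_def intro: add_nonneg_pos)
    have dotw: "(\<Sum>\<alpha>\<in>A. s \<alpha> * exp (y \<alpha>)) = dot s v + \<epsilon> * signomial A s x0" for s
    proof -
      have "(\<Sum>\<alpha>\<in>A. s \<alpha> * exp (y \<alpha>)) = dot s w" using w by (intro sum.cong) (auto simp: y_def)
      then show ?thesis by (simp add: w_def signomial_def algebra_simps sum.distrib sum_distrib_left)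
    qed
    have "\<epsilon> * signomial A c x0 \<le> \<epsilon> * N" using \<epsilon> by (intro mult_left_mono) (auto simp: N_def)
    also have "\<dots> = - dot c v / 2" using N by (simp add: \<epsilon>_def)
    finally have neg: "(\<Sum>\<alpha>\<in>A. c \<alpha> * exp (y \<alpha>)) < 0" using v(2) dotw[of c] by simp
    have "dot mu y + sig mu \<ge> 0" if mu: "mu \<in> Lambda_X_star X A" for mu
    proof (rule AGE_lambda_dual_converse)
      show "mu \<in> Lambda_X X A" using mu Lambda_X_star_subset by blast
      fix s assume "s \<in> AGE_lambda X A mu"
      then have s: "s \<in> reduced_sum" using mu AGE_lambda_subset_reduced_sum by blast
      then have "signomial A s x0 \<ge> 0"
        using SAGE_signomial_nonneg[OF _ x0] msum_AGE_subset_SAGE[OF Lambda_X_star_subset finite_Lambda_X_star] by blast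
      then show "0 \<le> (\<Sum>\<alpha>\<in>A. s \<alpha> * exp (y \<alpha>))"
        using v(1)[OF s] \<epsilon> dotw[of s] by simp
    qed
    then have "dot (fst p) y + snd p \<ge> 0" if "p \<in> circuit_graph X A" for p
      using that by (rule circuit_graph_dual)
    then have "dot \<nu> y + \<tau> \<ge> 0" if "(\<nu>, \<tau>) \<in> epi \<beta>" for \<nu> \<tau>
      using epi_subset_circuit_graph[OF \<beta>] that by fastforce
    then obtain x where x: "x \<in> X" "\<And>\<alpha>. \<alpha> \<in> A \<Longrightarrow> \<alpha> \<bullet> x - \<beta> \<bullet> x \<le> y \<alpha> - y \<beta>"
      using AGE_point_below[OF \<beta>, of y] by blast
    \<comment> \<open>The factor turns the \<beta> term into
      \<open>c \<beta> * exp (y \<beta>)\<close>; every other coefficient is nonnegative, so its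
      term only grows when the exponent is raised to \<open>y \<alpha>\<close>.\<close>
    have "0 \<le> signomial A c x * exp (y \<beta> - \<beta> \<bullet> x)"
      using c x(1) by (auto simp: SAGE_beta_def)
    also have "\<dots> = (\<Sum>\<alpha>\<in>A. c \<alpha> * exp (\<alpha> \<bullet> x - \<beta> \<bullet> x + y \<beta>))"
      unfolding signomial_def sum_distrib_right mult.assoc exp_add[symmetric] by (simp add: algebra_simps)
    also have "\<dots> \<le> (\<Sum>\<alpha>\<in>A. c \<alpha> * exp (y \<alpha>))"
    proof (rule sum_mono)
      fix \<alpha> assume \<alpha>: "\<alpha> \<in> A"
      show "c \<alpha> * exp (\<alpha> \<bullet> x - \<beta> \<bullet> x + y \<beta>) \<le> c \<alpha> * exp (y \<alpha>)"
      proof (cases "\<alpha> = \<beta>")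
        case False
        then show ?thesis
          using c \<alpha> x(2)[OF \<alpha>] by (intro mult_left_mono) (auto simp: SAGE_beta_def)
      qed simp
    qed
    finally show False using neg by simp
  qed
qed

lemma SAGE_eq_reduced_sum:
  assumes "Lambda_X X A \<noteq> {}"
  shows "SAGE X A = reduced_sum"
proof
  show "reduced_sum \<subseteq> SAGE X A"
    using Lambda_X_star_subset finite_Lambda_X_star by (rule msum_AGE_subset_SAGE)
  show "SAGE X A \<subseteq> reduced_sum"
  proof
    fix c assume "c \<in> SAGE X A"
    then obtain cs where cs: "\<And>\<beta>. \<beta> \<in> A \<Longrightarrow> cs \<beta> \<in> SAGE_beta X A \<beta>" "c = (\<lambda>\<alpha>. \<Sum>\<beta>\<in>A. cs \<beta> \<alpha>)"
      by (auto simp: SAGE_def msum_def)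
    then have "c = (\<Sum>\<beta>\<in>A. cs \<beta>)" by (simp add: fun_eq_iff sum_fun_apply)
    then show "c \<in> reduced_sum"
      using cs(1) SAGE_beta_subset_reduced_sum[OF assms]
      by (auto intro!: convex_cone_sum[OF convex_cone_reduced_sum])
  qed
qed

section \<open>Minimality of the set of reduced circuits\<close>

lemma reduced_circuit_not_generated:
  assumes L: "L \<subseteq> Lambda_X_star X A" and lam: "lam \<in> Lambda_X_star X A" "lam \<notin> L"
  shows "funform X A lam \<notin> convex_cone hull (funform X A ` L \<union> {(0, 1)})"
proof
  let ?T = "funform X A ` L \<union> {(0, 1)}"
  assume "funform X A lam \<in> convex_cone hull ?T"
  have finT: "finite ?T" using L finite_Lambda_X_star finite_subset by blast
  have ext: "extreme_ray (circuit_graph X A) (funform X A lam)" and lamX: "lam \<in> Lambda_X X A"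
    using lam by (auto simp: Lambda_X_star_def)
  have lam0: "lam \<noteq> 0" using circuit_props(3)[OF lamX] by auto
  have sub: "convex_cone hull ?T \<subseteq> circuit_graph X A"
    unfolding circuit_graph_reduced using L by (intro hull_mono) auto
  \<comment> \<open>Extremality passes to any smaller cone that still contains the vector, and there
    some generator must lie on the ray.\<close>
  have "extreme_ray (convex_cone hull ?T) (funform X A lam)"
    using ext sub \<open>funform X A lam \<in> convex_cone hull ?T\<close> unfolding extreme_ray_iff by blast
  then obtain s k where s: "s \<in> ?T" "k > 0" "s = k *\<^sub>R funform X A lam"
    using extreme_ray_multiple_of_generator[OF _ finT] by metis
  have "s \<noteq> (0, 1)" using s lam0 by (auto simp: funform_eq)
  then obtain mu where mu: "mu \<in> L" "s = funform X A mu" using s(1) by auto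
  then have "mu = k *\<^sub>R lam" using s(3) by (simp add: funform_eq)
  then have "mu = lam"
    using Lambda_X_scaleR_unique[OF lamX, of mu k] mu(1) s(2) L Lambda_X_star_subset by auto
  then show False using mu lam by simp
qed

lemma SAGE_neq_proper_msum:
  assumes "L \<subset> Lambda_X_star X A"
  shows "SAGE X A \<noteq> msum L (AGE_lambda X A)"
proof
  assume eq: "SAGE X A = msum L (AGE_lambda X A)"
  obtain lam where lam: "lam \<in> Lambda_X_star X A" "lam \<notin> L" using assms by blast
  have lamX: "lam \<in> Lambda_X X A" and LX: "L \<subseteq> Lambda_X X A"
    using lam assms Lambda_X_star_subset by blast+
  have finL: "finite L" using assms finite_Lambda_X_star finite_subset by blast
  let ?T = "funform X A ` L \<union> {(0, 1)}"
  have inRA: "in_RA A (fst s)" if "s \<in> ?T" for s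
    using that circuit_props(5) LX by (auto simp: funform_eq in_RA_def)
  have "in_RA A (fst (funform X A lam))" using circuit_props(5)[OF lamX] by (simp add: funform_eq)
  moreover have "funform X A lam \<notin> convex_cone hull ?T"
    using assms by (intro reduced_circuit_not_generated lam) auto
  moreover have "finite ?T" using finL by simp
  ultimately obtain y r where y: "\<forall>s\<in>?T. dot (fst s) y + snd s * r \<ge> 0"
      "dot (fst (funform X A lam)) y + snd (funform X A lam) * r < 0"
    using farkas_separation[OF finite _ inRA] by blast
  have r: "r \<ge> 0" using bspec[OF y(1), of "(0, 1)"] by simp
  have yL: "dot mu y + sig mu * r \<ge> 0" if "mu \<in> L" for mu
    using bspec[OF y(1), of "funform X A mu"] that by (simp add: funform_eq)
  have ylam: "dot lam y + sig lam * r < 0" using y(2) by (simp add: funform_eq)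
  obtain x0 where x0: "x0 \<in> X" using nonempty by blast
  define g where "g = (\<lambda>mu. dot mu (\<lambda>\<alpha>. \<alpha> \<bullet> x0) + sig mu)"
  have g: "g mu \<ge> 0" if "mu \<in> Lambda_X X A" for mu
    unfolding g_def by (rule circuit_at_point[OF that x0])
  \<comment> \<open>\<open>r\<close> may be 0, and then no rescaling gives a pair
    \<open>(y, 1)\<close>. Adding \<epsilon> times the evaluation at \<open>x0\<close>, which is
    nonnegative on all circuits, makes the last entry \<open>r + \<epsilon>\<close> positive;
    \<epsilon> cancels at most half of the negative value at \<open>lam\<close>.\<close>
  define N where "N = g lam + 1"
  have N: "N > 0" using g[OF lamX] by (simp add: N_def)
  define \<epsilon> where "\<epsilon> = - (dot lam y + sig lam * r) / (2 * N)"
  have \<epsilon>: "\<epsilon> > 0" using ylam N unfolding \<epsilon>_def by (intro divide_pos_pos) auto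
  define z where "z = (\<lambda>\<alpha>. (y \<alpha> + \<epsilon> * (\<alpha> \<bullet> x0)) / (r + \<epsilon>))"
  have rp: "r + \<epsilon> > 0" using r \<epsilon> by simp
  have dotz: "dot mu z + sig mu = ((dot mu y + sig mu * r) + \<epsilon> * g mu) / (r + \<epsilon>)" for mu
  proof -
    have "dot mu z = (dot mu y + \<epsilon> * dot mu (\<lambda>\<alpha>. \<alpha> \<bullet> x0)) / (r + \<epsilon>)"
      by (simp add: z_def sum_divide_distrib[symmetric] algebra_simps sum.distrib sum_distrib_left)
    then show ?thesis using rp by (simp add: g_def field_simps)
  qed
  have zL: "dot mu z + sig mu \<ge> 0" if "mu \<in> L" for mu
  proof -
    have "g mu \<ge> 0" using g that LX by blast
    then have "\<epsilon> * g mu \<ge> 0" using \<epsilon> by simp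
    then show ?thesis unfolding dotz using yL[OF that] rp by (intro divide_nonneg_pos) auto
  qed
  have "\<epsilon> * g lam \<le> \<epsilon> * N" using \<epsilon> by (intro mult_left_mono) (auto simp: N_def)
  also have "\<dots> = - (dot lam y + sig lam * r) / 2" using N by (simp add: \<epsilon>_def)
  finally have "dot lam z + sig lam < 0"
    unfolding dotz using ylam rp by (intro divide_neg_pos) auto
  \<comment> \<open>The exponential of \<open>z\<close> is nonnegative on the cones indexed by
    \<open>L\<close>, so under the assumed equality also on the cone witnessed by
    \<open>lam\<close>.\<close>
  moreover have "dot lam z + sig lam \<ge> 0"
  proof (rule AGE_lambda_dual_converse[OF lamX])
    fix c assume "c \<in> AGE_lambda X A lam"
    then have "c \<in> SAGE X A"
      using AGE_lambda_subset_reduced_sum[OF lam(1)]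
        msum_AGE_subset_SAGE[OF Lambda_X_star_subset finite_Lambda_X_star] by blast
    then obtain cs where cs: "\<And>mu. mu \<in> L \<Longrightarrow> cs mu \<in> AGE_lambda X A mu" "c = (\<lambda>\<alpha>. \<Sum>mu\<in>L. cs mu \<alpha>)"
      unfolding eq by (auto simp: msum_def)
    have "(\<Sum>\<alpha>\<in>A. c \<alpha> * exp (z \<alpha>)) = (\<Sum>mu\<in>L. \<Sum>\<alpha>\<in>A. cs mu \<alpha> * exp (z \<alpha>))"
      unfolding cs(2) sum_distrib_right by (rule sum.swap)
    also have "\<dots> \<ge> 0"
      using cs(1) LX zL by (intro sum_nonneg AGE_lambda_dual) auto
    finally show "0 \<le> (\<Sum>\<alpha>\<in>A. c \<alpha> * exp (z \<alpha>))" .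
  qed
  ultimately show False by simp
qed

end

theorem theorem5p6:
  fixes X :: "'a::euclidean_space set" and A :: "'a set"
  assumes "polyhedron X" and "X \<noteq> {}"
    and "finite A" and "A \<noteq> {}"
    and "exp_lin_indep_on X A"
    and "Lambda_X X A \<noteq> {}"
  shows "finite (Lambda_X_star X A) \<and>
         SAGE X A = msum (Lambda_X_star X A) (AGE_lambda X A) \<and>
         (\<forall>\<Lambda>. \<Lambda> \<subset> Lambda_X_star X A \<longrightarrow> SAGE X A \<noteq> msum \<Lambda> (AGE_lambda X A))"
proof -
  interpret polyhedral_signomials X A
    using assms by unfold_locales
  show ?thesis
    using finite_Lambda_X_star SAGE_eq_reduced_sum[OF assms(6)] SAGE_neq_proper_msum by blast
qed

end
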